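(* Let $\{v_j\}_{j=1}^\infty$ be a sequence of real numbers such that $v_j\to 0$ as $j\to\infty$. Then there exist functions $\widetilde N_k:\mathbb{N}^k\to\mathbb{N}$, $k\ge 1$ (depending only on $\{v_j\}_{j=1}^\infty$), such that the following holds. Let $\{N_j\}_{j=1}^\infty$ be any strictly increasing sequence of positive integers with $N_{j+1}/N_j\to\infty$ and $$N_{k+1}\ \ge\ \widetilde N_k(N_1,N_2,\ldots,N_k)\qquad\text{for every } k\ge 1 .$$ Let $\mu$ be the measure corresponding to the Jacobi parameters $$a_n= 1 \ \text{ for all } n\ge 1,\qquad b_n=\begin{cases} v_j & \text{if } n=N_j \text{ for some } j\ge 1,\\ 0 & \text{otherwise,}\end{cases}$$ and let $K_n(x,y)$ be the Christoffel–Darboux kernel of $\mu$. Then for every $x\in(-2,2)$ and any $a,b\in\mathbb{R}$, $$\lim_{n\to\infty}\frac{K_n\left(x+\frac an,\,x+\frac bn\right)}{K_n(x,x)}=\frac{\sin\left((\sqrt{4-x^2})^{-1}(b-a)\right)}{(\sqrt{4-x^2})^{-1}(b-a)} ,$$ where the right-hand side is interpreted as $1$ when $a=b$.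
   Context: Given bounded sequences $a_n>0$, $b_n\in\mathbb{R}$ ($n\ge1$), let $J$ be the Jacobi matrix, i.e. the bounded self-adjoint tridiagonal operator on $\ell^2(\{1,2,3,\dots\})$ with diagonal entries $J_{n,n}=b_n$ and off-diagonal entries $J_{n,n+1}=J_{n+1,n}=a_n$. The measure corresponding to the Jacobi parameters $\{a_n,b_n\}$ is the spectral measure $\mu$ of $J$ and the cyclic vector $e_1=(1,0,0,\ldots)^T$, that is, the unique compactly supported probability measure on $\mathbb{R}$ with $\int x^k\,d\mu(x)=\langle e_1,J^k e_1\rangle$ for all $k\ge 0$. The orthonormal polynomials $\{p_n\}_{n\ge0}$ of $\mu$ are the polynomials $p_n$ of degree $n$ with positive leading coefficient satisfying $\int p_np_m\,d\mu=\delta_{m,n}$; they satisfy $p_0=1$, $xp_0(x)=a_1p_1(x)+b_1p_0(x)$ and $xp_n(x)=a_{n+1}p_{n+1}(x)+b_{n+1}p_n(x)+a_np_{n-1}(x)$ for $n\ge1$. The Christoffel–Darboux kernel of $\mu$ is $K_n(x,y)=\sum_{j=0}^{n-1}p_j(x)p_j(y)$. *)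

theory Defs
  imports "HOL-Probability.Probability" "HOL-Computational_Algebra.Polynomial"
begin

text \<open>
  All sequences are indexed by \<open>{1, 2, 3, \<dots>}\<close>; the value at index 0 is never used.

  The Jacobi matrix acts by its tridiagonal formula on all real sequences; for bounded parameters its
  restriction to square-summable sequences is the bounded self-adjoint operator \<open>J\<close>. Only the vectors
  \<open>J\<^sup>k e\<^sub>1\<close> are needed below, and these are finitely supported, so the inner products are
  finite sums and agree with those of the sequence space.
\<close>

definition jacobi_op :: "(nat \<Rightarrow> real) \<Rightarrow> (nat \<Rightarrow> real) \<Rightarrow> (nat \<Rightarrow> real) \<Rightarrow> (nat \<Rightarrow> real)" where
  "jacobi_op a b f n =
     (if n = 0 then 0
      else (if n = 1 then 0 else a (n - 1) * f (n - 1)) + b n * f n + a n * f (n + 1))"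

definition unit_seq :: "nat \<Rightarrow> nat \<Rightarrow> real" where
  "unit_seq i n = (if n = i then 1 else 0)"

definition seq_inner :: "(nat \<Rightarrow> real) \<Rightarrow> (nat \<Rightarrow> real) \<Rightarrow> real" where
  "seq_inner f g = (\<Sum>n. f (Suc n) * g (Suc n))"

text \<open>
  \<open>\<mu>\<close> is the spectral measure of \<open>J\<close> and \<open>e\<^sub>1\<close>. The moments determine \<open>\<mu>\<close> because its support is
  compact; compactness of the support also makes every moment integrand integrable.
\<close>

definition jacobi_measure :: "(nat \<Rightarrow> real) \<Rightarrow> (nat \<Rightarrow> real) \<Rightarrow> real measure \<Rightarrow> bool" where
  "jacobi_measure a b \<mu> \<longleftrightarrow>
     prob_space \<mu> \<and> sets \<mu> = sets borel \<and>
     (\<exists>S. compact S \<and> (AE x in \<mu>. x \<in> S)) \<and>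
     (\<forall>k::nat. (\<integral>x. x ^ k \<partial>\<mu>) = seq_inner (unit_seq 1) ((jacobi_op a b ^^ k) (unit_seq 1)))"

definition is_orthonormal_polys :: "real measure \<Rightarrow> (nat \<Rightarrow> real poly) \<Rightarrow> bool" where
  "is_orthonormal_polys \<mu> p \<longleftrightarrow>
     (\<forall>n. degree (p n) = n \<and> lead_coeff (p n) > 0) \<and>
     (\<forall>m n. (\<integral>x. poly (p n) x * poly (p m) x \<partial>\<mu>) = (if m = n then 1 else 0))"

text \<open>
  The family below exists and is unique whenever \<open>\<mu>\<close> has all moments and infinite support, as is
  the case for the measure of any Jacobi parameters with positive off-diagonal entries.
\<close>

definition orthonormal_poly :: "real measure \<Rightarrow> nat \<Rightarrow> real poly" where
  "orthonormal_poly \<mu> = (THE p. is_orthonormal_polys \<mu> p)"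

definition CD_kernel :: "real measure \<Rightarrow> nat \<Rightarrow> real \<Rightarrow> real \<Rightarrow> real" where
  "CD_kernel \<mu> n x y = (\<Sum>j<n. poly (orthonormal_poly \<mu> j) x * poly (orthonormal_poly \<mu> j) y)"

definition sparse_potential :: "(nat \<Rightarrow> real) \<Rightarrow> (nat \<Rightarrow> nat) \<Rightarrow> nat \<Rightarrow> real" where
  "sparse_potential v N n =
     (if \<exists>j\<ge>1. n = N j then v (THE j. j \<ge> 1 \<and> n = N j) else 0)"

end

theory Submission
  imports Defs
begin

text \<open>
  The orthonormal polynomials obey the three-term recurrence of \<open>J\<close>, because \<open>p\<^sub>n(J) e\<^sub>1 = e\<^bsub>n+1\<^esub>\<close>. For
  \<open>x = 2 cos t\<close> write \<open>p\<^sub>n(x) sin t = Im (e\<^bsup>i(n+1)t\<^esup> w\<^sub>n(t))\<close>, where \<open>w\<^sub>n\<close> jumps only at the sites \<open>N\<^sub>j\<close>, by a relative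
  amount \<open>O(v\<^sub>j)\<close> whose dependence on \<open>t\<close> costs a factor \<open>O(N\<^sub>j)\<close>. Since the sites are sparse and
  \<open>v\<^sub>j \<longrightarrow> 0\<close>, these costs add up to \<open>o(m)\<close> over the indices \<open>n < m\<close>. Hence for angles \<open>O(1/m)\<close> away from \<open>t\<close>
  all \<open>w\<^sub>n\<close> with \<open>n < m\<close> may be replaced by the single number \<open>w\<^sub>m(t)\<close>, in mean square, and the kernel
  reduces to geometric sums.
\<close>

section \<open>Orthonormal polynomials of a Jacobi measure\<close>

text \<open>The reference is therefore a moving one, the value \<open>prufer b t m\<close> at the
  end of the summation range, and every error is measured relative to its modulus. That requires the
  modulus not to collapse from one site to the next, which is the reverse estimate
  \<open>cmod_prufer_le_Suc\<close>. The price is a constant factor per site, exponential in the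
  number of sites; since \<open>N j\<close> outgrows every exponential in \<open>j\<close>, this is
  affordable, and \<open>sparse_bound\<close> keeps the account. The same account serves two errors:
  the deviation within the range and the Lipschitz constant in the angle. In the end the phase of
  the reference value enters only a term that averages out, and its modulus cancels in the quotient
  of kernels.\<close>

fun jacobi_poly :: "(nat \<Rightarrow> real) \<Rightarrow> (nat \<Rightarrow> real) \<Rightarrow> nat \<Rightarrow> real poly" where
  "jacobi_poly a b 0 = 1"
| "jacobi_poly a b (Suc 0) = smult (inverse (a 1)) [:- b 1, 1:]"
| "jacobi_poly a b (Suc (Suc n)) = smult (inverse (a (n + 2)))
     ([:- b (n + 2), 1:] * jacobi_poly a b (Suc n) - smult (a (n + 1)) (jacobi_poly a b n))"

lemma degree_jacobi_poly:
  assumes "\<And>n. a n > 0"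
  shows "degree (jacobi_poly a b n) = n \<and> coeff (jacobi_poly a b n) n > 0"
proof (induction n rule: induct_nat_012)
  case (ge2 n)
  let ?P = "jacobi_poly a b"
  have lin: "degree [:- b (n + 2), 1:] = 1" "lead_coeff [:- b (n + 2), 1:] = 1" by simp_all
  have ne: "?P (Suc n) \<noteq> 0" using ge2 by auto
  have deg: "degree ([:- b (n + 2), 1:] * ?P (Suc n)) = Suc (Suc n)"
    by (subst degree_mult_eq) (use ne ge2 in auto)
  have small: "degree (smult (a (n + 1)) (?P n)) < Suc (Suc n)"
    using ge2 degree_smult_le[of "a (n + 1)" "?P n"] by auto
  have deg': "degree ([:- b (n + 2), 1:] * ?P (Suc n) - smult (a (n + 1)) (?P n)) = Suc (Suc n)"
    using degree_add_eq_left[of "- smult (a (n + 1)) (?P n)" "[:- b (n + 2), 1:] * ?P (Suc n)"] deg small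
    by simp
  have "coeff ([:- b (n + 2), 1:] * ?P (Suc n) - smult (a (n + 1)) (?P n)) (Suc (Suc n))
      = lead_coeff ([:- b (n + 2), 1:] * ?P (Suc n))"
    using deg coeff_eq_0[OF small] by (simp del: mult_pCons_left)
  also have "\<dots> = lead_coeff (?P (Suc n))"
    unfolding lead_coeff_mult lin by simp
  also have "\<dots> = coeff (?P (Suc n)) (Suc n)" using ge2 by simp
  finally have "coeff ([:- b (n + 2), 1:] * ?P (Suc n) - smult (a (n + 1)) (?P n)) (Suc (Suc n)) > 0"
    using ge2 by (simp del: mult_pCons_left)
  then show ?case
    using deg' assms[of "n + 2"] by (simp del: mult_pCons_left)
qed (use assms[of 1] in auto)

section \<open>Finitely supported vectors and symmetry of the Jacobi operator\<close>

text \<open>The condition \<open>f 0 = 0\<close> encodes the boundary of the half-line: under it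
  site 1 obeys the same three-term formula as every other site.\<close>

definition finite_seq :: "(nat \<Rightarrow> real) \<Rightarrow> bool" where
  "finite_seq f \<longleftrightarrow> f 0 = 0 \<and> (\<exists>M. \<forall>n>M. f n = 0)"

lemma seq_inner_eq_sum:
  assumes "\<And>n. n > M \<Longrightarrow> f n = 0"
  shows "seq_inner f g = (\<Sum>n<M. f (Suc n) * g (Suc n))"
  unfolding seq_inner_def by (rule suminf_finite) (use assms in auto)

lemma seq_inner_commute: "seq_inner f g = seq_inner g f"
  by (simp add: seq_inner_def mult.commute)

lemma finite_seq_unit: "i > 0 \<Longrightarrow> finite_seq (unit_seq i)"
  by (auto simp: finite_seq_def unit_seq_def)

lemma finite_seq_lincomb:
  assumes "finite_seq f" "finite_seq g"
  shows "finite_seq (\<lambda>n. c * f n + d * g n)"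
proof -
  obtain M M' where "\<forall>n>M. f n = 0" "\<forall>n>M'. g n = 0"
    using assms by (auto simp: finite_seq_def)
  then have "\<forall>n>max M M'. c * f n + d * g n = 0" by simp
  then show ?thesis using assms unfolding finite_seq_def by (intro conjI exI[of _ "max M M'"]) auto
qed

lemma finite_seq_jacobi_op:
  assumes "finite_seq f"
  shows "finite_seq (jacobi_op a b f)"
proof -
  obtain M where "\<forall>n>M. f n = 0" using assms by (auto simp: finite_seq_def)
  then have "\<forall>n>Suc M. jacobi_op a b f n = 0" by (simp add: jacobi_op_def)
  moreover have "jacobi_op a b f 0 = 0" by (simp add: jacobi_op_def)
  ultimately show ?thesis unfolding finite_seq_def by blast
qed

lemma seq_inner_lincomb:
  assumes "finite_seq h"
  shows "seq_inner (\<lambda>n. c * f n + d * g n) h = c * seq_inner f h + d * seq_inner g h"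
proof -
  obtain M where M: "\<And>n. n > M \<Longrightarrow> h n = 0" using assms by (auto simp: finite_seq_def)
  have *: "seq_inner k h = (\<Sum>n<M. h (Suc n) * k (Suc n))" for k
    unfolding seq_inner_commute[of k] by (rule seq_inner_eq_sum) (rule M)
  show ?thesis unfolding * by (simp add: sum_distrib_left sum.distrib algebra_simps)
qed

lemma jacobi_op_symmetric:
  assumes "finite_seq f" "finite_seq g"
  shows "seq_inner (jacobi_op a b f) g = seq_inner f (jacobi_op a b g)"
proof -
  obtain M M' where "\<forall>n>M. f n = 0" "\<forall>n>M'. g n = 0"
    using assms by (auto simp: finite_seq_def)
  then obtain L where L: "\<And>n. n > L \<Longrightarrow> f n = 0" "\<And>n. n > L \<Longrightarrow> g n = 0"
    by (metis max_less_iff_conj)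
  have [simp]: "f 0 = 0" "g 0 = 0" using assms by (auto simp: finite_seq_def)
  have J: "jacobi_op a b h (Suc n) = a n * h n + b (Suc n) * h (Suc n) + a (Suc n) * h (n + 2)"
    if "h 0 = 0" for h n
    using that by (simp add: jacobi_op_def)
  \<comment> \<open>Moving the index by one exchanges the two off-diagonals. Nothing is left at the
    ends, since \<open>h\<close> vanishes at 0 and \<open>k\<close> beyond \<open>L\<close>.\<close>
  have shift: "(\<Sum>n<L. a n * h n * k (Suc n)) = (\<Sum>n<L. a (Suc n) * h (Suc n) * k (n + 2))"
    if "h 0 = 0" "\<And>n. n > L \<Longrightarrow> k n = 0" for h k
  proof -
    have "(\<Sum>n<L. a n * h n * k (Suc n)) = (\<Sum>n<Suc L. a n * h n * k (Suc n))"
      using that by simp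
    also have "\<dots> = (\<Sum>n<L. a (Suc n) * h (Suc n) * k (n + 2))"
      using that by (subst sum.lessThan_Suc_shift) simp
    finally show ?thesis .
  qed
  have "seq_inner (jacobi_op a b f) g = (\<Sum>n<L. g (Suc n) * jacobi_op a b f (Suc n))"
    by (subst seq_inner_commute, rule seq_inner_eq_sum) (rule L)
  also have "\<dots> = (\<Sum>n<L. a n * f n * g (Suc n)) + (\<Sum>n<L. b (Suc n) * f (Suc n) * g (Suc n))
      + (\<Sum>n<L. a (Suc n) * g (Suc n) * f (n + 2))"
    unfolding sum.distrib[symmetric] by (rule sum.cong) (simp_all add: J algebra_simps)
  also have "\<dots> = (\<Sum>n<L. a (Suc n) * f (Suc n) * g (n + 2))
      + (\<Sum>n<L. b (Suc n) * f (Suc n) * g (Suc n)) + (\<Sum>n<L. a n * g n * f (Suc n))"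
    by (simp only: shift[of f g] shift[of g f] L \<open>f 0 = 0\<close> \<open>g 0 = 0\<close>)
  also have "\<dots> = (\<Sum>n<L. f (Suc n) * jacobi_op a b g (Suc n))"
    unfolding sum.distrib[symmetric] by (rule sum.cong) (simp_all add: J algebra_simps)
  also have "\<dots> = seq_inner f (jacobi_op a b g)"
    by (rule seq_inner_eq_sum[symmetric]) (rule L)
  finally show ?thesis .
qed

text \<open>The vector \<open>p(J) e\<^sub>1\<close>.\<close>

definition poly_jacobi :: "(nat \<Rightarrow> real) \<Rightarrow> (nat \<Rightarrow> real) \<Rightarrow> real poly \<Rightarrow> nat \<Rightarrow> real" where
  "poly_jacobi a b p n = (\<Sum>k\<le>degree p. coeff p k * (jacobi_op a b ^^ k) (unit_seq 1) n)"

lemma poly_jacobi_eq: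
  assumes "degree p \<le> M"
  shows "poly_jacobi a b p n = (\<Sum>k\<le>M. coeff p k * (jacobi_op a b ^^ k) (unit_seq 1) n)"
  unfolding poly_jacobi_def
  by (rule sum.mono_neutral_left) (use assms in \<open>auto simp: coeff_eq_0\<close>)

lemma poly_jacobi_lincomb:
  "poly_jacobi a b (smult c p + smult d q) = (\<lambda>n. c * poly_jacobi a b p n + d * poly_jacobi a b q n)"
proof
  fix n
  define M where "M = max (degree p) (degree q)"
  have *: "degree p \<le> M" "degree q \<le> M" "degree (smult c p + smult d q) \<le> M"
    unfolding M_def by (auto intro: degree_add_le order_trans[OF degree_smult_le])
  show "poly_jacobi a b (smult c p + smult d q) n = c * poly_jacobi a b p n + d * poly_jacobi a b q n"
    unfolding poly_jacobi_eq[OF *(1)] poly_jacobi_eq[OF *(2)] poly_jacobi_eq[OF *(3)]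
    by (simp add: sum_distrib_left sum.distrib algebra_simps)
qed

lemma jacobi_op_sum:
  "jacobi_op a b (\<lambda>n. \<Sum>k\<in>A. c k * f k n) n = (\<Sum>k\<in>A. c k * jacobi_op a b (f k) n)"
  by (simp add: jacobi_op_def sum_distrib_left sum.distrib algebra_simps)

lemma poly_jacobi_pCons:
  "poly_jacobi a b (pCons c p) n = c * unit_seq 1 n + jacobi_op a b (poly_jacobi a b p) n"
proof -
  have "poly_jacobi a b (pCons c p) n
      = (\<Sum>k\<le>Suc (degree p). coeff (pCons c p) k * (jacobi_op a b ^^ k) (unit_seq 1) n)"
    by (rule poly_jacobi_eq) (simp add: degree_pCons_le)
  also have "\<dots> = c * unit_seq 1 n
      + (\<Sum>k\<le>degree p. coeff p k * jacobi_op a b ((jacobi_op a b ^^ k) (unit_seq 1)) n)"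
    by (subst sum.atMost_Suc_shift) simp
  finally show ?thesis
    by (simp add: jacobi_op_sum poly_jacobi_def[abs_def])
qed

lemma poly_jacobi_0: "poly_jacobi a b 0 = (\<lambda>n. 0)"
  by (rule ext) (simp add: poly_jacobi_def)

lemma poly_jacobi_1: "poly_jacobi a b 1 = unit_seq 1"
  by (rule ext) (simp add: poly_jacobi_def)

lemma finite_seq_poly_jacobi: "finite_seq (poly_jacobi a b p)"
proof (induction p)
  case 0
  show ?case by (simp add: finite_seq_def poly_jacobi_0)
next
  case (pCons c p)
  have "finite_seq (\<lambda>n. c * unit_seq 1 n + 1 * jacobi_op a b (poly_jacobi a b p) n)"
    by (intro finite_seq_lincomb finite_seq_unit finite_seq_jacobi_op pCons) simp
  then show ?case by (simp add: poly_jacobi_pCons[abs_def])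
qed

text \<open>Symmetry moves the factors of \<open>J\<close> across the inner product one at a time.
  The other polynomial absorbs each factor, so it is kept arbitrary in the induction.\<close>

lemma seq_inner_poly_jacobi:
  "seq_inner (poly_jacobi a b p) (poly_jacobi a b q) = seq_inner (unit_seq 1) (poly_jacobi a b (p * q))"
proof (induction p arbitrary: q)
  case 0
  show ?case by (simp add: poly_jacobi_0 seq_inner_def)
next
  case (pCons c p)
  let ?V = "poly_jacobi a b" and ?J = "jacobi_op a b"
  have "seq_inner (?V (pCons c p)) (?V q) = seq_inner (\<lambda>n. c * unit_seq 1 n + 1 * ?J (?V p) n) (?V q)"
    by (simp add: poly_jacobi_pCons[abs_def])
  also have "\<dots> = c * seq_inner (unit_seq 1) (?V q) + 1 * seq_inner (?J (?V p)) (?V q)"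
    by (rule seq_inner_lincomb) (rule finite_seq_poly_jacobi)
  also have "seq_inner (?J (?V p)) (?V q) = seq_inner (?V p) (?J (?V q))"
    by (intro jacobi_op_symmetric finite_seq_poly_jacobi)
  also have "?J (?V q) = ?V (pCons 0 q)"
    by (rule ext) (simp add: poly_jacobi_pCons)
  also have "seq_inner (?V p) (?V (pCons 0 q)) = seq_inner (unit_seq 1) (?V (pCons 0 (p * q)))"
    by (simp add: pCons.IH)
  also have "c * seq_inner (unit_seq 1) (?V q) + 1 * seq_inner (unit_seq 1) (?V (pCons 0 (p * q)))
     = seq_inner (unit_seq 1) (\<lambda>n. c * ?V q n + 1 * ?V (pCons 0 (p * q)) n)"
    by (subst (1 2 3) seq_inner_commute, rule seq_inner_lincomb[symmetric]) (simp add: finite_seq_unit)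
  also have "(\<lambda>n. c * ?V q n + 1 * ?V (pCons 0 (p * q)) n) = ?V (smult c q + smult 1 (pCons 0 (p * q)))"
    by (rule poly_jacobi_lincomb[symmetric])
  also have "smult c q + smult 1 (pCons 0 (p * q)) = pCons c p * q"
    by simp
  finally show ?case .
qed

lemma seq_inner_unit_seq:
  assumes "i > 0"
  shows "seq_inner (unit_seq i) f = f i"
proof -
  obtain k where k: "i = Suc k" using assms by (cases i) auto
  have "seq_inner (unit_seq i) f = (\<Sum>n<i. unit_seq i (Suc n) * f (Suc n))"
    by (rule seq_inner_eq_sum) (simp add: unit_seq_def)
  then show ?thesis by (simp add: k unit_seq_def)
qed

text \<open>\<open>J\<close> sends \<open>unit_seq (n + 2)\<close> to a combination of
  \<open>unit_seq (n + 1)\<close>, \<open>unit_seq (n + 2)\<close> and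
  \<open>unit_seq (n + 3)\<close>. Solving for the last of these is exactly the recurrence that
  defines \<open>jacobi_poly\<close>.\<close>

lemma poly_jacobi_jacobi_poly:
  assumes "\<And>n. a n > 0"
  shows "poly_jacobi a b (jacobi_poly a b n) = unit_seq (Suc n)"
proof (induction n rule: induct_nat_012)
  case 0
  show ?case by (simp add: poly_jacobi_1)
next
  case 1
  have "jacobi_poly a b 1 = smult (inverse (a 1)) (pCons 0 1) + smult (- b 1 * inverse (a 1)) 1"
    by (simp add: one_pCons)
  then have "poly_jacobi a b (jacobi_poly a b 1) = (\<lambda>n. inverse (a 1) * poly_jacobi a b (pCons 0 1) n
      + (- b 1 * inverse (a 1)) * poly_jacobi a b 1 n)"
    by (simp only: poly_jacobi_lincomb)
  also have "\<dots> = unit_seq (Suc 1)"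
    using assms[of 1]
    by (auto simp: poly_jacobi_pCons poly_jacobi_1 jacobi_op_def unit_seq_def field_simps fun_eq_iff)
  finally show ?case by simp
next
  case (ge2 n)
  let ?P = "jacobi_poly a b" and ?c = "inverse (a (Suc (Suc n)))"
  have "?P (Suc (Suc n)) = smult 1 (smult ?c (pCons 0 (?P (Suc n))) + smult (- b (n + 2) * ?c) (?P (Suc n)))
      + smult (- a (n + 1) * ?c) (?P n)"
    by (simp add: smult_diff_right smult_add_right algebra_simps)
  then have "poly_jacobi a b (?P (Suc (Suc n))) = (\<lambda>k. 1 * (?c * poly_jacobi a b (pCons 0 (?P (Suc n))) k
      + (- b (n + 2) * ?c) * unit_seq (Suc (Suc n)) k) + (- a (n + 1) * ?c) * unit_seq (Suc n) k)"
    by (simp only: poly_jacobi_lincomb ge2)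
  also have "\<dots> = unit_seq (Suc (Suc (Suc n)))"
    using assms[of "Suc (Suc n)"]
    by (auto simp: poly_jacobi_pCons ge2 jacobi_op_def unit_seq_def field_simps fun_eq_iff numeral_3_eq_3)
  finally show ?case .
qed

section \<open>Integrals against the spectral measure and uniqueness of the orthonormal
  family\<close>

lemma jacobi_measure_integrable_poly:
  assumes "jacobi_measure a b \<mu>"
  shows "integrable \<mu> (poly p)"
proof -
  obtain S where S: "compact S" "AE x in \<mu>. x \<in> S" and sets: "sets \<mu> = sets borel"
    and "prob_space \<mu>"
    using assms by (auto simp: jacobi_measure_def)
  interpret prob_space \<mu> by fact
  have "compact (poly p ` S)"
    by (intro compact_continuous_image continuous_intros S)
  then obtain B where B: "\<forall>x\<in>S. norm (poly p x) \<le> B"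
    by (auto dest!: compact_imp_bounded simp: bounded_iff)
  have "poly p \<in> borel_measurable borel"
    by (intro borel_measurable_continuous_onI continuous_intros)
  then have "poly p \<in> borel_measurable \<mu>"
    using sets by (simp cong: measurable_cong_sets)
  then show ?thesis
    by (rule integrable_const_bound[where B = B, rotated]) (use S(2) B in auto)
qed

lemma jacobi_measure_integral_poly:
  assumes "jacobi_measure a b \<mu>"
  shows "(\<integral>x. poly p x \<partial>\<mu>) = seq_inner (unit_seq 1) (poly_jacobi a b p)"
proof -
  have int: "integrable \<mu> (\<lambda>x. x ^ k)" for k
    using jacobi_measure_integrable_poly[OF assms, of "monom 1 k"] by (simp add: poly_monom[abs_def])
  have mom: "(\<integral>x. x ^ k \<partial>\<mu>) = (jacobi_op a b ^^ k) (unit_seq 1) 1" for k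
    using assms by (simp add: jacobi_measure_def seq_inner_unit_seq)
  have "(\<integral>x. poly p x \<partial>\<mu>) = (\<Sum>k\<le>degree p. coeff p k * (\<integral>x. x ^ k \<partial>\<mu>))"
    unfolding poly_altdef by (subst Bochner_Integration.integral_sum) (auto intro: int)
  then show ?thesis
    by (simp add: mom seq_inner_unit_seq poly_jacobi_def)
qed

lemma is_orthonormal_jacobi_poly:
  assumes "jacobi_measure a b \<mu>" "\<And>n. a n > 0"
  shows "is_orthonormal_polys \<mu> (jacobi_poly a b)"
proof -
  have "(\<integral>x. poly (jacobi_poly a b n) x * poly (jacobi_poly a b m) x \<partial>\<mu>) = (if m = n then 1 else 0)" for m n
    using jacobi_measure_integral_poly[OF assms(1), of "jacobi_poly a b n * jacobi_poly a b m"]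
    unfolding seq_inner_poly_jacobi[symmetric] poly_jacobi_jacobi_poly[OF assms(2)] poly_mult
    by (simp add: seq_inner_unit_seq unit_seq_def)
  then show ?thesis
    using degree_jacobi_poly[of a b, OF assms(2)] by (simp add: is_orthonormal_polys_def)
qed

text \<open>Subtracting a multiple of \<open>P n\<close> removes the top coefficient. The case
  \<open>p = 0\<close> is listed separately because the zero polynomial has degree 0, which is not
  below \<open>n = 0\<close>.\<close>

lemma poly_as_sum_of_degree_sequence:
  fixes P :: "nat \<Rightarrow> 'a :: field poly"
  assumes "\<And>k. degree (P k) = k" "\<And>k. P k \<noteq> 0" "p = 0 \<or> degree p < n"
  shows "\<exists>c. p = (\<Sum>k<n. smult (c k) (P k))"
  using assms(3)
proof (induction n arbitrary: p)
  case 0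
  then show ?case by auto
next
  case (Suc n)
  define d where "d = coeff p n / lead_coeff (P n)"
  have "degree (p - smult d (P n)) \<le> n"
    using Suc.prems assms(1)[of n] by (intro degree_diff_le order_trans[OF degree_smult_le]) auto
  moreover have "coeff (p - smult d (P n)) n = 0"
    using assms(1)[of n] assms(2)[of n] by (simp add: d_def) (metis leading_coeff_0_iff)
  ultimately have "p - smult d (P n) = 0 \<or> degree (p - smult d (P n)) < n"
    by (metis leading_coeff_0_iff order_neq_le_trans)
  then obtain c where c: "p - smult d (P n) = (\<Sum>k<n. smult (c k) (P k))"
    using Suc.IH by blast
  have "p = (\<Sum>k<Suc n. smult ((c(n := d)) k) (P k))"
    using c by (simp add: algebra_simps)
  then show ?case by blast
qed

text \<open>Needed to evaluate the definite description in \<open>orthonormal_poly\<close>. After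
  the leading terms are matched, \<open>Q n - c P n\<close> has lower degree and is orthogonal to
  all earlier members, hence zero; the normalisation and the positive leading coefficients then
  force \<open>c = 1\<close>.\<close>

lemma is_orthonormal_polys_unique:
  assumes int: "\<And>p. integrable \<mu> (poly p)"
    and P: "is_orthonormal_polys \<mu> P" and Q: "is_orthonormal_polys \<mu> Q"
  shows "P = Q"
proof
  fix n
  define L where "L = (\<lambda>p. \<integral>x. poly p x \<partial>\<mu>)"
  have L_diff: "L (p - q) = L p - L q" and L_smult: "L (smult c p) = c * L p" for p q c
    using int unfolding L_def poly_diff poly_smult by (simp_all add: Bochner_Integration.integral_diff)
  have L_sum: "L (\<Sum>k\<in>A. f k) = (\<Sum>k\<in>A. L (f k))" for A :: "nat set" and f
    unfolding L_def poly_sum by (rule Bochner_Integration.integral_sum) (rule int)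
  have LP: "L (P i * P j) = (if i = j then 1 else 0)" and LQ: "L (Q i * Q j) = (if i = j then 1 else 0)" for i j
    using P Q by (simp_all add: is_orthonormal_polys_def L_def poly_mult[abs_def])
  have dP: "degree (P k) = k" "lead_coeff (P k) > 0" and dQ: "degree (Q k) = k" "lead_coeff (Q k) > 0" for k
    using P Q unfolding is_orthonormal_polys_def by blast+
  have ne: "P k \<noteq> 0" for k using dP(2)[of k] by auto
  show "P n = Q n"
  proof (induction n rule: less_induct)
    case (less n)
    define c where "c = lead_coeff (Q n) / lead_coeff (P n)"
    define r where "r = Q n - smult c (P n)"
    have "c > 0" using dP dQ by (simp add: c_def)
    have "degree r \<le> n"
      unfolding r_def using dP dQ by (intro degree_diff_le order_trans[OF degree_smult_le]) auto
    moreover have "coeff r n = 0"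
      using dP(1)[of n] dQ(1)[of n] dP(2)[of n] by (simp add: r_def c_def)
    ultimately have "r = 0 \<or> degree r < n"
      by (metis leading_coeff_0_iff order_neq_le_trans)
    then obtain d where d: "r = (\<Sum>k<n. smult (d k) (P k))"
      using poly_as_sum_of_degree_sequence[of P r n] dP ne by blast
    have "d k = 0" if "k < n" for k
    proof -
      have "L (r * P k) = (\<Sum>j<n. d j * L (P j * P k))"
        unfolding d sum_distrib_right L_sum by (simp add: L_smult)
      also have "\<dots> = d k"
        using that by (subst sum.remove[of _ k]) (auto simp: LP)
      finally have "d k = L (r * P k)" by simp
      \<comment> \<open>By the induction hypothesis \<open>P k = Q k\<close>, so orthogonality
        within the family \<open>Q\<close> applies to the first term.\<close>
      also have "\<dots> = L (Q n * Q k) - c * L (P n * P k)"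
        using less[OF that] by (simp add: r_def L_diff L_smult left_diff_distrib)
      also have "\<dots> = 0" using that by (simp add: LP LQ)
      finally show ?thesis .
    qed
    then have "r = 0" by (simp add: d)
    then have Qn: "Q n = smult c (P n)" by (simp add: r_def)
    then have "c * c = 1"
      using LQ[of n n] LP[of n n] by (simp add: L_smult)
    then have "c = 1" using \<open>c > 0\<close> by (simp add: square_eq_1_iff)
    then show ?case using Qn by simp
  qed
qed

lemma orthonormal_poly_eq_jacobi_poly:
  assumes "jacobi_measure a b \<mu>" "\<And>n. a n > 0"
  shows "orthonormal_poly \<mu> = jacobi_poly a b"
  unfolding orthonormal_poly_def
  using is_orthonormal_jacobi_poly[OF assms]
    is_orthonormal_polys_unique[OF jacobi_measure_integrable_poly[OF assms(1)]]
  by (intro the_equality)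

section \<open>Sparse sums\<close>

lemma contracting_recurrence_tendsto_0:
  fixes g e f :: "nat \<Rightarrow> real"
  assumes "\<And>n. g n \<ge> 0" "\<And>n. e n \<ge> 0"
    and step: "eventually (\<lambda>n. g (Suc n) \<le> e n * g n + f n) sequentially"
    and "e \<longlonglongrightarrow> 0" "f \<longlonglongrightarrow> 0"
  shows "g \<longlonglongrightarrow> 0"
proof (rule LIMSEQ_I)
  fix r :: real assume "r > 0"
  have "eventually (\<lambda>n. e n < 1 / 2) sequentially" "eventually (\<lambda>n. f n < r / 4) sequentially"
    using order_tendstoD(2)[OF assms(4), of "1 / 2"] order_tendstoD(2)[OF assms(5), of "r / 4"] \<open>r > 0\<close>
    by simp_all
  with step have "eventually (\<lambda>n. g (Suc n) \<le> g n / 2 + r / 4) sequentially"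
  proof eventually_elim
    case (elim n)
    have "e n * g n \<le> 1 / 2 * g n"
      by (rule mult_right_mono) (use elim assms(1) in auto)
    then show ?case using elim by simp
  qed
  then obtain J where J: "\<And>n. n \<ge> J \<Longrightarrow> g (Suc n) \<le> g n / 2 + r / 4"
    by (auto simp: eventually_sequentially)
  \<comment> \<open>\<open>r / 2\<close> is the fixed point of the map sending \<open>y\<close> to
    \<open>y / 2 + r / 4\<close>; the distance to it is halved at each step.\<close>
  have bound: "g (k + J) \<le> (1 / 2) ^ k * g J + r / 2" for k
  proof (induction k)
    case (Suc k)
    then show ?case using J[of "k + J"] by simp
  qed (use \<open>r > 0\<close> in simp)
  have "(\<lambda>k. (1 / 2) ^ k * g J) \<longlonglongrightarrow> 0 * g J"
    by (intro tendsto_intros LIMSEQ_power_zero) simp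
  then have "eventually (\<lambda>k. (1 / 2) ^ k * g J < r / 2) sequentially"
    using \<open>r > 0\<close> by (intro order_tendstoD(2)[where a = "r / 2"]) auto
  then obtain K where K: "\<And>k. k \<ge> K \<Longrightarrow> (1 / 2) ^ k * g J < r / 2"
    by (auto simp: eventually_sequentially)
  show "\<exists>no. \<forall>n\<ge>no. norm (g n - 0) < r"
  proof (intro exI allI impI)
    fix n assume "n \<ge> K + J"
    then have "n - J \<ge> K" by simp
    then have "g (n - J + J) < r" using bound[of "n - J"] K[of "n - J"] by simp
    then show "norm (g n - 0) < r" using \<open>n \<ge> K + J\<close> assms(1)[of n] by simp
  qed
qed

text \<open>An error budget: at an occupied site \<open>q\<close> pays for changing the reference
  value and the second term is the new error, proportional to the potential and to the position.
  Empty sites are free; without that exception the factor \<open>q\<close> would be applied at every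
  index and the growth could be exponential.\<close>

primrec sparse_bound :: "real \<Rightarrow> real \<Rightarrow> (nat \<Rightarrow> real) \<Rightarrow> nat \<Rightarrow> real" where
  "sparse_bound q c b 0 = 0"
| "sparse_bound q c b (Suc n) = (if b (Suc n) = 0 then sparse_bound q c b n
     else q * sparse_bound q c b n + c * \<bar>b (Suc n)\<bar> * real (Suc n))"

lemma sparse_bound_nonneg: "q \<ge> 0 \<Longrightarrow> c \<ge> 0 \<Longrightarrow> sparse_bound q c b n \<ge> 0"
  by (induction n) auto

lemma sparse_bound_mono:
  assumes "q \<ge> 1" "c \<ge> 0"
  shows "mono (sparse_bound q c b)"
proof (rule mono_iff_le_Suc[THEN iffD2], intro allI)
  fix n
  have "1 * sparse_bound q c b n \<le> q * sparse_bound q c b n"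
    using assms sparse_bound_nonneg[of q c b n] by (intro mult_right_mono) auto
  moreover have "0 \<le> c * \<bar>b (Suc n)\<bar> * real (Suc n)" using assms by simp
  ultimately show "sparse_bound q c b n \<le> sparse_bound q c b (Suc n)" by simp
qed

text \<open>At the sites, the quotient \<open>g j\<close> of the bound by \<open>N j\<close> is
  multiplied by at most \<open>q * N j / N (j + 1)\<close>, which tends to 0, and increased by at
  most \<open>c * \<bar>b (N (j + 1))\<bar>\<close>, which also tends to 0. Between sites the bound
  is constant while \<open>n\<close> grows, so the quotient only decreases.\<close>

lemma sparse_bound_sublinear:
  fixes N :: "nat \<Rightarrow> nat"
  assumes qc: "q \<ge> 1" "c \<ge> 0"
    and mono: "strict_mono_on {1..} N" and pos: "\<And>j. j \<ge> 1 \<Longrightarrow> N j > 0"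
    and ratio: "filterlim (\<lambda>j. real (N (j + 1)) / real (N j)) at_top sequentially"
    and zero: "\<And>n. n \<notin> N ` {1..} \<Longrightarrow> b n = 0"
    and lim: "(\<lambda>j. b (N j)) \<longlonglongrightarrow> 0"
  shows "(\<lambda>n. sparse_bound q c b n / real n) \<longlonglongrightarrow> 0"
proof -
  let ?A = "sparse_bound q c b"
  have nn: "?A n \<ge> 0" for n using qc by (intro sparse_bound_nonneg) auto
  have less: "N i < N j" if "1 \<le> i" "i < j" for i j
    using strict_mono_onD[OF mono, of i j] that by simp
  have gap: "b n = 0" if "j \<ge> 1" "N j < n" "n < N (Suc j)" for j n
  proof (rule zero, rule notI)
    assume "n \<in> N ` {1..}"
    then obtain i where "i \<ge> 1" "n = N i" by auto
    then show False
      using that less[of i j] less[of "Suc j" i] by (cases i j rule: linorder_cases) (auto simp: Suc_lessI, metis Suc_lessI less_asym')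
  qed
  have const: "?A n = ?A (N j)" if "j \<ge> 1" "N j \<le> n" "n < N (Suc j)" for j n
    using that(2,3)
  proof (induction n rule: dec_induct)
    case (step n)
    then show ?case using gap[of j "Suc n"] that(1) by simp
  qed simp
  define g where "g j = ?A (N j) / real (N j)" for j
  have g_lim: "g \<longlonglongrightarrow> 0"
  proof (rule contracting_recurrence_tendsto_0)
    show "eventually (\<lambda>j. g (Suc j) \<le> q * (real (N j) / real (N (Suc j))) * g j + c * \<bar>b (N (Suc j))\<bar>) sequentially"
      using eventually_ge_at_top[of 1]
    proof eventually_elim
      case (elim j)
      define M where "M = N (Suc j) - 1"
      have M: "N (Suc j) = Suc M" "N j \<le> M" "N j > 0"
        using less[of j "Suc j"] elim pos[of j] by (auto simp: M_def)
      have "?A M = ?A (N j)" using const[of j M] elim M by simp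
      moreover have "?A (Suc M) \<le> q * ?A M + c * \<bar>b (Suc M)\<bar> * real (Suc M)"
        using qc nn[of M] mult_right_mono[of 1 q "?A M"] by simp
      ultimately have "?A (N (Suc j)) \<le> q * ?A (N j) + c * \<bar>b (N (Suc j))\<bar> * real (N (Suc j))"
        using M by simp
      then have "g (Suc j) \<le> (q * ?A (N j) + c * \<bar>b (N (Suc j))\<bar> * real (N (Suc j))) / real (N (Suc j))"
        unfolding g_def by (rule divide_right_mono) simp
      also have "\<dots> = q * (real (N j) / real (N (Suc j))) * g j + c * \<bar>b (N (Suc j))\<bar>"
        using M(1,3) by (simp add: g_def add_divide_distrib del: of_nat_Suc)
      finally show ?case .
    qed
    have "(\<lambda>j. inverse (real (N (j + 1)) / real (N j))) \<longlonglongrightarrow> 0"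
      by (rule tendsto_inverse_0_at_top) (rule ratio)
    then have "(\<lambda>j. q * (real (N j) / real (N (Suc j)))) \<longlonglongrightarrow> q * 0"
      by (intro tendsto_mult tendsto_const) (simp add: inverse_eq_divide)
    then show "(\<lambda>j. q * (real (N j) / real (N (Suc j)))) \<longlonglongrightarrow> 0" by simp
    have "(\<lambda>j. c * \<bar>b (N (Suc j))\<bar>) \<longlonglongrightarrow> c * \<bar>0\<bar>"
      by (intro tendsto_intros LIMSEQ_Suc[OF lim])
    then show "(\<lambda>j. c * \<bar>b (N (Suc j))\<bar>) \<longlonglongrightarrow> 0" by simp
  qed (use qc nn in \<open>auto simp: g_def\<close>)
  show ?thesis
  proof (rule LIMSEQ_I)
    fix r :: real assume "r > 0"
    then obtain J where J: "\<And>j. j \<ge> J \<Longrightarrow> g j < r / 2"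
      using order_tendstoD(2)[OF g_lim, of "r / 2"] by (auto simp: eventually_sequentially)
    \<comment> \<open>\<open>N 0\<close> is unconstrained, so the induction must start at a site of
      index at least 1.\<close>
    define J' where "J' = max J 1"
    have "?A n \<le> r / 2 * real n" if "n \<ge> N J'" for n
      using that
    proof (induction n rule: dec_induct)
      case base
      have "N J' > 0" by (intro pos) (simp add: J'_def)
      then show ?case using J[of J'] by (simp add: g_def J'_def field_simps)
    next
      case (step n)
      show ?case
      proof (cases "Suc n \<in> N ` {1..}")
        case True
        then obtain j where j: "j \<ge> 1" "Suc n = N j" by auto
        have "j \<ge> J'" using less[of j J'] step(1) j by (intro leI notI) auto
        then have "j \<ge> J" by (simp add: J'_def)
        then show ?thesis using J[of j] pos[of j] j by (simp add: g_def field_simps)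
      next
        case False
        then have "?A (Suc n) = ?A n" by (simp add: zero)
        then show ?thesis using step \<open>r > 0\<close> by (simp add: field_simps)
      qed
    qed
    moreover have "r / 2 * real n < r * real n" if "n \<ge> Suc (N J')" for n
      using that \<open>r > 0\<close> by simp
    ultimately have "?A n < r * real n" if "n \<ge> Suc (N J')" for n
      using that by (meson Suc_leD le_less_trans)
    then show "\<exists>no. \<forall>n\<ge>no. norm (?A n / real n - 0) < r"
      using nn by (intro exI[of _ "Suc (N J')"]) (auto simp: divide_less_eq)
  qed
qed

section \<open>Pruefer variables\<close>

text \<open>
  With \<open>x = 2 cos t\<close>, the free recurrence multiplies \<open>p\<^sub>n(x) - e\<^bsup>-it\<^esup> p\<^bsub>n-1\<^esub>(x)\<close> by \<open>e\<^bsup>it\<^esup>\<close>.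
  The sequence below is that quantity times \<open>e\<^bsup>-int\<^esup>\<close>, so it changes only where \<open>b\<close> is nonzero.
\<close>

primrec prufer :: "(nat \<Rightarrow> real) \<Rightarrow> real \<Rightarrow> nat \<Rightarrow> complex" where
  "prufer b t 0 = 1"
| "prufer b t (Suc n) = prufer b t n
     - of_real (b (Suc n) / sin t * Im (cis (real (Suc n) * t) * prufer b t n)) * cis (- (real (Suc n) * t))"

declare prufer.simps(2) [simp del]

text \<open>The imaginary part in \<open>prufer\<close> is there to recover the polynomial value:
  \<open>e^(it) p_(n+1) - p_n\<close> has imaginary part \<open>sin t * p_(n+1)\<close> because the
  polynomials are real at \<open>2 cos t\<close>. Thus a step of \<open>prufer\<close> subtracts
  precisely the potential term of the recurrence.\<close>

lemma prufer_eq_jacobi_poly: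
  assumes "sin t \<noteq> 0"
  shows "cis (real (Suc n) * t) * prufer b t (Suc n) = of_real (poly (jacobi_poly (\<lambda>_. 1) b (Suc n)) (2 * cos t))
      - cis (- t) * of_real (poly (jacobi_poly (\<lambda>_. 1) b n) (2 * cos t))"
proof (induction n)
  case 0
  have "cis t * prufer b t (Suc 0) = cis t - of_real (b 1 / sin t * sin t) * (cis t * cis (- t))"
    by (simp add: prufer.simps(2) right_diff_distrib)
  also have "\<dots> = cis t - of_real (b 1)"
    unfolding cis_mult using assms by simp
  finally show ?case by (simp add: complex_eq_iff)
next
  case (Suc n)
  let ?p = "\<lambda>n. poly (jacobi_poly (\<lambda>_. 1) b n) (2 * cos t)"
  have shift: "cis (real (Suc (Suc n)) * t) = cis t * cis (real (Suc n) * t)"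
    by (simp add: cis_mult algebra_simps)
  have z: "cis (real (Suc (Suc n)) * t) * prufer b t (Suc n) = cis t * of_real (?p (Suc n)) - of_real (?p n)"
    unfolding shift mult.assoc Suc by (simp add: cis_mult right_diff_distrib flip: mult.assoc)
  have "cis (real (Suc (Suc n)) * t) * prufer b t (Suc (Suc n)) = cis (real (Suc (Suc n)) * t) * prufer b t (Suc n)
      - of_real (b (Suc (Suc n)) / sin t * Im (cis (real (Suc (Suc n)) * t) * prufer b t (Suc n)))
        * (cis (real (Suc (Suc n)) * t) * cis (- (real (Suc (Suc n)) * t)))"
    unfolding prufer.simps(2)[of _ _ "Suc n"] by (simp only: right_diff_distrib mult_ac)
  also have "\<dots> = cis t * of_real (?p (Suc n)) - of_real (?p n) - of_real (b (Suc (Suc n)) * ?p (Suc n))"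
    unfolding z cis_mult using assms by simp
  also have "\<dots> = of_real (?p (Suc (Suc n))) - cis (- t) * of_real (?p (Suc n))"
    by (simp add: complex_eq_iff algebra_simps)
  finally show ?case .
qed

lemma jacobi_poly_eq_prufer:
  assumes "sin t \<noteq> 0"
  shows "poly (jacobi_poly (\<lambda>_. 1) b n) (2 * cos t) = Im (cis (real (Suc n) * t) * prufer b t n) / sin t"
proof (cases n)
  case (Suc m)
  let ?p = "\<lambda>n. poly (jacobi_poly (\<lambda>_. 1) b n) (2 * cos t)"
  have "cis (real (Suc n) * t) * prufer b t n = cis t * (cis (real (Suc m) * t) * prufer b t n)"
    unfolding Suc mult.assoc[symmetric] cis_mult by (simp add: algebra_simps)
  also have "\<dots> = cis t * of_real (?p (Suc m)) - of_real (?p m)"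
    unfolding Suc prufer_eq_jacobi_poly[OF assms]
    by (simp add: cis_mult right_diff_distrib flip: mult.assoc)
  finally show ?thesis using assms Suc by simp
qed (use assms in simp)

lemma cmod_Im_cis_le: "\<bar>Im (cis x * w)\<bar> \<le> cmod w"
  using abs_Im_le_cmod[of "cis x * w"] by (simp add: norm_mult)

lemma cmod_prufer_diff_le:
  "cmod (prufer b t (Suc n) - prufer b t n) \<le> \<bar>b (Suc n)\<bar> / \<bar>sin t\<bar> * cmod (prufer b t n)"
  using mult_left_mono[OF cmod_Im_cis_le[of "real (Suc n) * t" "prufer b t n"], of "\<bar>b (Suc n)\<bar> / \<bar>sin t\<bar>"]
  by (simp add: prufer.simps(2) norm_mult norm_divide abs_mult del: times_complex.sel of_real_mult of_real_divide)

text \<open>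
  The step map is unipotent: reversing the sign of the potential inverts it. So a step changes the modulus by
  a factor close to 1 in both directions, however large the potential is.
\<close>

lemma cmod_prufer_le_Suc:
  "cmod (prufer b t n) \<le> (1 + \<bar>b (Suc n)\<bar> / \<bar>sin t\<bar>) * cmod (prufer b t (Suc n))"
proof -
  let ?w = "prufer b t n" and ?w' = "prufer b t (Suc n)" and ?x = "real (Suc n) * t" and ?r = "b (Suc n) / sin t"
  \<comment> \<open>In the rotated frame the step subtracts a real number, so the imaginary part
    that determines the step is itself unchanged. Adding the same correction back therefore inverts
    the step.\<close>
  have "Im (cis ?x * ?w') = Im (cis ?x * ?w) - Im (of_real (?r * Im (cis ?x * ?w)) * (cis ?x * cis (- ?x)))"
    unfolding prufer.simps(2) by (simp only: right_diff_distrib minus_complex.sel mult_ac)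
  then have "Im (cis ?x * ?w') = Im (cis ?x * ?w)"
    unfolding cis_mult by simp
  then have "?w = ?w' + of_real (?r * Im (cis ?x * ?w')) * cis (- ?x)"
    unfolding prufer.simps(2) by simp
  then have "cmod ?w \<le> cmod ?w' + cmod (of_real (?r * Im (cis ?x * ?w')) * cis (- ?x))"
    by (metis norm_triangle_ineq)
  also have "\<dots> = cmod ?w' + \<bar>b (Suc n)\<bar> / \<bar>sin t\<bar> * \<bar>Im (cis ?x * ?w')\<bar>"
    by (simp add: norm_mult abs_mult del: times_complex.sel of_real_mult of_real_divide)
  also have "\<dots> \<le> cmod ?w' + \<bar>b (Suc n)\<bar> / \<bar>sin t\<bar> * cmod ?w'"
    by (intro add_left_mono mult_left_mono cmod_Im_cis_le) simp
  finally show ?thesis by (simp add: algebra_simps)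
qed

text \<open>This licenses division by the modulus of the reference value. It covers
  \<open>sin t = 0\<close> too, where the quotient in \<open>prufer\<close> is 0 by convention and
  the sequence stays at 1.\<close>

lemma cmod_prufer_pos: "cmod (prufer b t n) > 0"
proof (induction n)
  case (Suc n)
  then show ?case using cmod_prufer_le_Suc[of b t n] by (cases "prufer b t (Suc n) = 0") auto
qed simp

text \<open>\<open>s\<close> bounds the reciprocal of \<open>\<bar>sin t\<bar>\<close> and
  \<open>B\<close> the potential, so that one factor serves all sites and all angles near the base
  angle.\<close>

lemma cmod_prufer_le_Suc_bound:
  assumes "1 \<le> s * \<bar>sin t\<bar>" "\<bar>b (Suc n)\<bar> \<le> B"
  shows "cmod (prufer b t n) \<le> (1 + s * B) * cmod (prufer b t (Suc n))"
proof -
  have "sin t \<noteq> 0" using assms by auto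
  then have "1 / \<bar>sin t\<bar> \<le> s" using assms(1) by (simp add: divide_le_eq)
  then have "1 / \<bar>sin t\<bar> * \<bar>b (Suc n)\<bar> \<le> s * B"
    using assms(2) by (intro mult_mono) (auto intro: order_trans[rotated])
  then have "(1 + \<bar>b (Suc n)\<bar> / \<bar>sin t\<bar>) * cmod (prufer b t (Suc n)) \<le> (1 + s * B) * cmod (prufer b t (Suc n))"
    by (intro mult_right_mono) auto
  then show ?thesis using cmod_prufer_le_Suc[of b t n] by linarith
qed

text \<open>All terms are compared with the last value, so an occupied site changes every earlier
  term. The 2 comes from \<open>(x + y)^2 \<le> 2 x^2 + 2 y^2\<close>, and
  \<open>(1 + s * B)^2\<close> from expressing the old squared modulus by the new one. The jump
  itself is counted once for each index up to the site, which gives the factor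
  \<open>Suc n\<close>.\<close>

lemma prufer_mean_square_deviation:
  assumes s: "1 \<le> s * \<bar>sin t\<bar>" and B: "\<And>n. \<bar>b (Suc n)\<bar> \<le> B"
  shows "(\<Sum>k<n. (cmod (prufer b t k - prufer b t n))\<^sup>2)
    \<le> sparse_bound (2 * (1 + s * B)\<^sup>2) (2 * s\<^sup>2 * B * (1 + s * B)\<^sup>2) b n * (cmod (prufer b t n))\<^sup>2"
proof (induction n)
  case (Suc n)
  let ?w = "prufer b t" and ?q = "1 + s * B"
  let ?A = "sparse_bound (2 * ?q\<^sup>2) (2 * s\<^sup>2 * B * ?q\<^sup>2) b"
  have "B \<ge> 0" using B[of 0] by linarith
  have sn: "sin t \<noteq> 0" using s by auto
  then have s': "1 / \<bar>sin t\<bar> \<le> s" using s by (simp add: divide_le_eq)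
  then have "s \<ge> 0" using order_trans[of 0 "1 / \<bar>sin t\<bar>" s] by simp
  have q: "?q \<ge> 1" using \<open>s \<ge> 0\<close> \<open>B \<ge> 0\<close> by simp
  show ?case
  proof (cases "b (Suc n) = 0")
    case True
    then show ?thesis using Suc by (simp add: prufer.simps(2))
  next
    case False
    have sq: "(cmod (?w n))\<^sup>2 \<le> ?q\<^sup>2 * (cmod (?w (Suc n)))\<^sup>2"
      using power_mono[OF cmod_prufer_le_Suc_bound[of s t b n B, OF s B] norm_ge_zero, of 2]
      by (simp add: power_mult_distrib)
    have step: "cmod (?w (Suc n) - ?w n) \<le> s * \<bar>b (Suc n)\<bar> * cmod (?w n)"
      using cmod_prufer_diff_le[of b t n] mult_right_mono[OF s', of "\<bar>b (Suc n)\<bar> * cmod (?w n)"]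
      by (simp add: mult_ac)
    have "(cmod (?w (Suc n) - ?w n))\<^sup>2 \<le> (s * \<bar>b (Suc n)\<bar> * cmod (?w n))\<^sup>2"
      by (intro power_mono step) simp
    also have "\<dots> = s\<^sup>2 * (\<bar>b (Suc n)\<bar> * \<bar>b (Suc n)\<bar>) * (cmod (?w n))\<^sup>2"
      by (simp add: power_mult_distrib power2_eq_square)
    \<comment> \<open>One of the two factors \<open>\<bar>b (Suc n)\<bar>\<close> is traded for
      \<open>B\<close>, to match the form of \<open>sparse_bound\<close>, which is linear in the
      potential.\<close>
    also have "\<dots> \<le> s\<^sup>2 * (B * \<bar>b (Suc n)\<bar>) * (?q\<^sup>2 * (cmod (?w (Suc n)))\<^sup>2)"
      using B sq \<open>B \<ge> 0\<close> by (intro mult_mono mult_right_mono) auto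
    finally have d: "(cmod (?w (Suc n) - ?w n))\<^sup>2 \<le> s\<^sup>2 * (B * \<bar>b (Suc n)\<bar>) * (?q\<^sup>2 * (cmod (?w (Suc n)))\<^sup>2)" .
    have "(cmod (?w k - ?w (Suc n)))\<^sup>2 \<le> 2 * (cmod (?w k - ?w n))\<^sup>2 + 2 * (cmod (?w (Suc n) - ?w n))\<^sup>2" for k
    proof -
      have "cmod (?w k - ?w (Suc n)) \<le> cmod (?w k - ?w n) + cmod (?w (Suc n) - ?w n)"
        using norm_triangle_ineq4[of "?w k - ?w n" "?w (Suc n) - ?w n"] by simp
      then have "(cmod (?w k - ?w (Suc n)))\<^sup>2 \<le> (cmod (?w k - ?w n) + cmod (?w (Suc n) - ?w n))\<^sup>2"
        by (intro power_mono) auto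
      then show ?thesis
        using sum_squares_bound[of "cmod (?w k - ?w n)" "cmod (?w (Suc n) - ?w n)"]
        by (simp add: power2_sum)
    qed
    then have "(\<Sum>k<Suc n. (cmod (?w k - ?w (Suc n)))\<^sup>2)
        \<le> (\<Sum>k<Suc n. 2 * (cmod (?w k - ?w n))\<^sup>2 + 2 * (cmod (?w (Suc n) - ?w n))\<^sup>2)"
      by (intro sum_mono)
    also have "\<dots> = 2 * (\<Sum>k<n. (cmod (?w k - ?w n))\<^sup>2) + 2 * real (Suc n) * (cmod (?w (Suc n) - ?w n))\<^sup>2"
      by (simp add: sum.distrib sum_distrib_left)
    also have "\<dots> \<le> 2 * (?A n * (?q\<^sup>2 * (cmod (?w (Suc n)))\<^sup>2))
        + 2 * real (Suc n) * (s\<^sup>2 * (B * \<bar>b (Suc n)\<bar>) * (?q\<^sup>2 * (cmod (?w (Suc n)))\<^sup>2))"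
      using Suc d mult_left_mono[OF sq, of "?A n"] \<open>B \<ge> 0\<close>
      by (intro add_mono mult_left_mono) (auto simp: sparse_bound_nonneg)
    also have "\<dots> = ?A (Suc n) * (cmod (?w (Suc n)))\<^sup>2"
      using False by (simp add: algebra_simps)
    finally show ?thesis .
  qed
qed simp

lemma norm_cis_diff_le: "cmod (cis x - cis y) \<le> \<bar>x - y\<bar>"
proof -
  have "cis x - cis y = cis y * (exp (\<i> * of_real (x - y)) - 1)"
    by (simp add: right_diff_distrib cis_mult flip: cis_conv_exp of_real_diff)
  then have "cmod (cis x - cis y) = 2 * \<bar>sin ((x - y) / 2)\<bar>"
    by (simp only: norm_mult norm_cis dist_exp_i_1)
  also have "\<dots> \<le> \<bar>x - y\<bar>"
    using abs_sin_x_le_abs_x[of "(x - y) / 2"] by simp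
  finally show ?thesis .
qed

text \<open>The vector, the factor \<open>1 / sin t\<close> and the phase are changed one after the
  other. The phase occurs twice, inside \<open>Im\<close> and in the outer exponential, whence
  \<open>2 * s\<close>; the change of \<open>1 / sin t\<close> gives \<open>s^2\<close>. Since
  \<open>n \<ge> 1\<close>, both are charged to \<open>n * \<bar>t' - t\<bar>\<close>.\<close>

lemma prufer_step_lipschitz:
  assumes s: "1 \<le> s * sin t" "1 \<le> s * sin t'" "s > 0" and x: "\<bar>x' - x\<bar> \<le> n * \<bar>t' - t\<bar>" "n \<ge> 1"
  shows "cmod (of_real (Im (cis x' * w') / sin t') * cis (- x') - of_real (Im (cis x * w) / sin t) * cis (- x))
      \<le> s * cmod (w' - w) + (s\<^sup>2 + 2 * s) * n * \<bar>t' - t\<bar> * cmod w"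
proof -
  define F where "F = (\<lambda>r y u. of_real (r * Im (cis y * u)) * cis (- y))"
  have pos: "sin t > 0" "sin t' > 0" using s mult_nonneg_nonpos[of s "sin t"] mult_nonneg_nonpos[of s "sin t'"] by (auto simp: not_less[symmetric] simp del: not_less)
  have inv: "inverse (sin t) \<le> s" "inverse (sin t') \<le> s" using s pos by (simp_all add: field_simps)
  define d where "d = n * \<bar>t' - t\<bar>"
  have "d \<ge> \<bar>t' - t\<bar>" unfolding d_def using x(2) mult_right_mono[of 1 n "\<bar>t' - t\<bar>"] by simp
  have 1: "cmod (F (inverse (sin t')) x' w' - F (inverse (sin t')) x' w) \<le> s * cmod (w' - w)"
  proof -
    have "F (inverse (sin t')) x' w' - F (inverse (sin t')) x' w = F (inverse (sin t')) x' (w' - w)"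
      by (simp add: F_def algebra_simps)
    also have "cmod \<dots> = inverse (sin t') * \<bar>Im (cis x' * (w' - w))\<bar>"
      using pos by (simp add: F_def norm_mult abs_mult del: times_complex.sel of_real_mult of_real_inverse)
    also have "\<dots> \<le> s * cmod (w' - w)"
      using inv pos s by (intro mult_mono cmod_Im_cis_le) auto
    finally show ?thesis .
  qed
  have 2: "cmod (F (inverse (sin t')) x' w - F (inverse (sin t)) x' w) \<le> s\<^sup>2 * d * cmod w"
  proof -
    have "F (inverse (sin t')) x' w - F (inverse (sin t)) x' w = F (inverse (sin t') - inverse (sin t)) x' w"
      by (simp add: F_def left_diff_distrib)
    also have "cmod \<dots> = \<bar>inverse (sin t') - inverse (sin t)\<bar> * \<bar>Im (cis x' * w)\<bar>"
      by (simp add: F_def norm_mult abs_mult del: times_complex.sel of_real_mult of_real_inverse of_real_diff)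
    also have "\<bar>inverse (sin t') - inverse (sin t)\<bar> = inverse (sin t') * inverse (sin t) * \<bar>sin t' - sin t\<bar>"
      using pos by (subst inverse_diff_inverse) (auto simp: abs_mult)
    also have "\<dots> * \<bar>Im (cis x' * w)\<bar> \<le> (s * s * d) * cmod w"
      using inv pos s \<open>d \<ge> \<bar>t' - t\<bar>\<close> abs_Im_le_cmod[of "cis t' - cis t"] norm_cis_diff_le[of t' t]
      by (intro mult_mono cmod_Im_cis_le) auto
    finally show ?thesis by (simp add: power2_eq_square)
  qed
  have 3: "cmod (F (inverse (sin t)) x' w - F (inverse (sin t)) x w) \<le> 2 * s * d * cmod w"
  proof -
    have D: "F r x' w - F r x w = of_real (r * Im (cis x' * w)) * (cis (- x') - cis (- x))
        + of_real (r * Im ((cis x' - cis x) * w)) * cis (- x)" for r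
      by (simp add: F_def algebra_simps)
    have "cmod (F (inverse (sin t)) x' w - F (inverse (sin t)) x w)
      \<le> inverse (sin t) * \<bar>Im (cis x' * w)\<bar> * cmod (cis (- x') - cis (- x))
        + inverse (sin t) * \<bar>Im ((cis x' - cis x) * w)\<bar>"
      unfolding D using pos by (intro order_trans[OF norm_triangle_ineq]) (simp add: norm_mult abs_mult del: times_complex.sel of_real_mult of_real_inverse)
    also have "\<dots> \<le> s * cmod w * d + s * (d * cmod w)"
    proof (intro add_mono mult_mono cmod_Im_cis_le inv)
      show "cmod (cis (- x') - cis (- x)) \<le> d"
        using norm_cis_diff_le[of "- x'" "- x"] x(1) by (simp add: d_def)
      have "cmod ((cis x' - cis x) * w) \<le> d * cmod w"
        unfolding norm_mult using norm_cis_diff_le[of x' x] x(1) by (intro mult_right_mono) (auto simp: d_def)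
      then show "\<bar>Im ((cis x' - cis x) * w)\<bar> \<le> d * cmod w"
        using abs_Im_le_cmod order_trans by blast
    qed (use s in auto)
    finally show ?thesis by (simp add: algebra_simps)
  qed
  have "cmod (F (inverse (sin t')) x' w' - F (inverse (sin t)) x w)
      \<le> s * cmod (w' - w) + s\<^sup>2 * d * cmod w + 2 * s * d * cmod w"
    using norm_diff_triangle_le[OF norm_diff_triangle_le[OF 1 2] 3] by simp
  then show ?thesis by (simp add: F_def d_def divide_inverse algebra_simps)
qed

text \<open>Each occupied site amplifies the existing difference by at most \<open>1 + s * B\<close>
  and adds the phase error of its own position. A second factor \<open>1 + s * B\<close> restates
  the bound relative to the modulus after the step, at the angle \<open>t\<close> alone.\<close>

lemma prufer_angle_dependence:
  assumes s: "1 \<le> s * sin t" "1 \<le> s * sin t'" "s > 0" and B: "\<And>n. \<bar>b (Suc n)\<bar> \<le> B"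
  shows "cmod (prufer b t' n - prufer b t n)
    \<le> sparse_bound ((1 + s * B)\<^sup>2) ((s\<^sup>2 + 2 * s) * (1 + s * B)) b n * \<bar>t' - t\<bar> * cmod (prufer b t n)"
proof (induction n)
  case (Suc n)
  have "B \<ge> 0" using B[of 0] by linarith
  let ?w = "prufer b t" and ?w' = "prufer b t'" and ?b = "b (Suc n)"
  define q where "q = 1 + s * B"
  define c where "c = s\<^sup>2 + 2 * s"
  define A where "A = sparse_bound (q\<^sup>2) (c * q) b"
  note IH = Suc[folded q_def, folded c_def, folded A_def]
  have q: "q \<ge> 1" and "c \<ge> 0" using s \<open>B \<ge> 0\<close> by (simp_all add: q_def c_def)
  have "A n \<ge> 0" using q \<open>c \<ge> 0\<close> by (simp add: A_def sparse_bound_nonneg)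
  have "sin t > 0" using s mult_nonneg_nonpos[of s "sin t"] by (cases "sin t > 0") auto
  have "cmod (?w' (Suc n) - ?w (Suc n)) \<le> A (Suc n) * \<bar>t' - t\<bar> * cmod (?w (Suc n))"
  proof (cases "?b = 0")
    case True
    then show ?thesis using IH by (simp add: prufer.simps(2) A_def)
  next
    case False
    let ?G = "\<lambda>t w. of_real (Im (cis (real (Suc n) * t) * w) / sin t) * cis (- (real (Suc n) * t))"
    have G: "prufer b t (Suc n) = prufer b t n - of_real ?b * ?G t (prufer b t n)" for t
      by (simp add: prufer.simps(2) mult_ac del: times_complex.sel)
    have diff_mult: "(x - c * u) - (y - c * v) = (x - y) - c * (u - v)" for x y u v c :: complex
      by (simp add: algebra_simps)
    have "?w' (Suc n) - ?w (Suc n) = (?w' n - ?w n) - of_real ?b * (?G t' (?w' n) - ?G t (?w n))"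
      unfolding G by (rule diff_mult)
    then have "cmod (?w' (Suc n) - ?w (Suc n)) \<le> cmod (?w' n - ?w n) + \<bar>?b\<bar> * cmod (?G t' (?w' n) - ?G t (?w n))"
      by (metis norm_triangle_ineq4 norm_mult norm_of_real)
    also have "\<dots> \<le> cmod (?w' n - ?w n)
        + \<bar>?b\<bar> * (s * cmod (?w' n - ?w n) + c * real (Suc n) * \<bar>t' - t\<bar> * cmod (?w n))"
      unfolding c_def
    proof (intro add_left_mono mult_left_mono prufer_step_lipschitz s)
      show "\<bar>real (Suc n) * t' - real (Suc n) * t\<bar> \<le> real (Suc n) * \<bar>t' - t\<bar>"
        unfolding right_diff_distrib[symmetric] abs_mult by simp
    qed auto
    also have "\<dots> = (1 + s * \<bar>?b\<bar>) * cmod (?w' n - ?w n) + c * \<bar>?b\<bar> * real (Suc n) * \<bar>t' - t\<bar> * cmod (?w n)"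
      by (simp only: algebra_simps)
    also have "\<dots> \<le> q * (A n * \<bar>t' - t\<bar> * cmod (?w n)) + c * \<bar>?b\<bar> * real (Suc n) * \<bar>t' - t\<bar> * cmod (?w n)"
    proof (intro add_right_mono mult_mono IH)
      show "1 + s * \<bar>?b\<bar> \<le> q"
        unfolding q_def by (intro add_left_mono mult_left_mono B) (use s in auto)
    qed (use q in auto)
    also have "\<dots> = (q * A n + c * \<bar>?b\<bar> * real (Suc n)) * \<bar>t' - t\<bar> * cmod (?w n)"
      by (simp only: algebra_simps)
    also have "\<dots> \<le> (q * A n + c * \<bar>?b\<bar> * real (Suc n)) * \<bar>t' - t\<bar> * (q * cmod (?w (Suc n)))"
    proof (intro mult_left_mono)
      show "cmod (?w n) \<le> q * cmod (?w (Suc n))"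
        unfolding q_def by (rule cmod_prufer_le_Suc_bound) (use s \<open>sin t > 0\<close> B in auto)
      show "0 \<le> (q * A n + c * \<bar>?b\<bar> * real (Suc n)) * \<bar>t' - t\<bar>"
        using q \<open>c \<ge> 0\<close> \<open>A n \<ge> 0\<close> by (intro mult_nonneg_nonneg add_nonneg_nonneg) auto
    qed
    also have "\<dots> = (q\<^sup>2 * A n + c * q * \<bar>?b\<bar> * real (Suc n)) * \<bar>t' - t\<bar> * cmod (?w (Suc n))"
      by (simp only: power2_eq_square algebra_simps)
    also have "\<dots> = A (Suc n) * \<bar>t' - t\<bar> * cmod (?w (Suc n))"
      using False by (simp add: A_def)
    finally show ?thesis .
  qed
  then show ?case unfolding A_def q_def c_def .
qed simp

section \<open>Sine kernel asymptotics\<close>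

text \<open>Origin of the scale in the sine kernel: \<open>arccos (x / 2)\<close> has derivative
  \<open>- 1 / sqrt (4 - x^2)\<close>. The case \<open>a = 0\<close> is split off because the
  difference quotient needs a nonzero increment.\<close>

lemma arccos_half_shift_tendsto:
  assumes "-2 < x" "x < 2"
  shows "(\<lambda>m. real m * (arccos ((x + a / real m) / 2) - arccos (x / 2))) \<longlonglongrightarrow> - a / sqrt (4 - x\<^sup>2)"
proof (cases "a = 0")
  case False
  define f where "f = (\<lambda>h. arccos ((x + h) / 2))"
  have "(f has_real_derivative inverse (- sqrt (1 - ((x + 0) / 2)\<^sup>2)) * (1 / 2)) (at 0)"
    unfolding f_def
    by (rule DERIV_chain2[of arccos _ "\<lambda>h. (x + h) / 2", OF DERIV_arccos]) (use assms in \<open>auto intro!: derivative_eq_intros\<close>)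
  moreover have "sqrt (4 - x\<^sup>2) = 2 * sqrt (1 - (x / 2)\<^sup>2)"
    using real_sqrt_mult[of 4 "1 - (x / 2)\<^sup>2"] by (simp add: power_divide right_diff_distrib)
  ultimately have "(f has_real_derivative - 1 / sqrt (4 - x\<^sup>2)) (at 0)"
    by (simp add: inverse_eq_divide mult.commute)
  then have lim: "(\<lambda>h. (f h - f 0) / h) \<midarrow>0\<rightarrow> - 1 / sqrt (4 - x\<^sup>2)"
    by (simp add: DERIV_def)
  have "filterlim (\<lambda>m. a / real m) (at 0) sequentially"
    unfolding filterlim_at
    using False by (auto intro!: tendsto_divide_0[OF tendsto_const] filterlim_at_top_imp_at_infinity
      filterlim_real_sequentially eventually_mono[OF eventually_gt_at_top[of 0]])
  from filterlim_compose[OF lim this]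
  have "(\<lambda>m. a * ((f (a / real m) - f 0) / (a / real m))) \<longlonglongrightarrow> a * (- 1 / sqrt (4 - x\<^sup>2))"
    by (intro tendsto_mult tendsto_const)
  then show ?thesis using False by (simp add: f_def mult.commute)
qed simp

lemma angle_tendsto:
  assumes "(\<lambda>m. real m * (t m - t0)) \<longlonglongrightarrow> (\<alpha>::real)"
  shows "t \<longlonglongrightarrow> t0"
proof -
  have "(\<lambda>m. real m * (t m - t0) * inverse (real m)) \<longlonglongrightarrow> \<alpha> * 0"
    by (intro tendsto_mult assms lim_inverse_n)
  moreover have "\<forall>\<^sub>F m in sequentially. real m * (t m - t0) * inverse (real m) = t m - t0"
    using eventually_gt_at_top[of 0] by eventually_elim simp
  ultimately have "(\<lambda>m. t m - t0) \<longlonglongrightarrow> 0"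
    by (simp add: tendsto_cong)
  then show ?thesis by (simp add: LIM_zero_iff)
qed

section \<open>Means of cosines and of exponentials\<close>

text \<open>The telescoped Dirichlet kernel, written with \<open>sinc\<close> so that it also holds
  at \<open>d = 0\<close>; the angle differences below may vanish.\<close>

lemma sum_cos_sinc:
  assumes "m > 0"
  shows "sinc (d / 2) * ((\<Sum>n<m. cos (real (Suc n) * d)) / real m)
    = (1 + 1 / (2 * real m)) * sinc ((real m + 1 / 2) * d) - 1 / (2 * real m) * sinc (d / 2)"
proof (cases "d = 0")
  case False
  have "2 * sin (d / 2) * (\<Sum>n<m. cos (real (Suc n) * d)) = sin ((real m + 1 / 2) * d) - sin (d / 2)"
  proof (induction m)
    case (Suc m)
    have "2 * sin (d / 2) * cos (real (Suc m) * d) = sin ((real (Suc m) + 1 / 2) * d) - sin ((real m + 1 / 2) * d)"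
      unfolding sin_diff_sin by (simp add: algebra_simps add_divide_distrib)
    then show ?case using Suc by (simp add: distrib_left)
  qed simp
  then have sum: "(\<Sum>n<m. cos (real (Suc n) * d)) * (2 * sin (d / 2)) = sin ((real m + 1 / 2) * d) - sin (d / 2)"
    by (simp only: mult.commute)
  have "(real m + 1 / 2) * d \<noteq> 0" using False by (simp add: add_nonneg_eq_0_iff)
  moreover have "(1 + 1 / (2 * real m)) * (sin ((real m + 1 / 2) * d) / ((real m + 1 / 2) * d))
      = sin ((real m + 1 / 2) * d) / (real m * d)"
    using assms False by (simp add: divide_simps)
  moreover have "1 / (2 * real m) * (sin (d / 2) / (d / 2)) = sin (d / 2) / (real m * d)"
    by simp
  moreover have "sin (d / 2) / (d / 2) * ((\<Sum>n<m. cos (real (Suc n) * d)) / real m)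
      = (\<Sum>n<m. cos (real (Suc n) * d)) * (2 * sin (d / 2)) / (real m * d)"
    by (simp add: mult_ac)
  ultimately show ?thesis
    using False unfolding sum diff_divide_distrib by simp
qed (use assms in simp)

text \<open>In effect a Riemann sum for the integral of \<open>cos (\<tau> * u)\<close> over the
  unit interval. The limit is read off from the closed form after division by
  \<open>sinc (d m / 2)\<close>, which tends to 1.\<close>

lemma mean_cos_tendsto_sinc:
  assumes "(\<lambda>m. real m * d m) \<longlonglongrightarrow> \<tau>"
  shows "(\<lambda>m. (\<Sum>n<m. cos (real (Suc n) * d m)) / real m) \<longlonglongrightarrow> sinc \<tau>"
proof -
  have d0: "d \<longlonglongrightarrow> 0" using angle_tendsto[of d 0 \<tau>] assms by simp
  have sinc: "((\<lambda>m. sinc (f m)) \<longlongrightarrow> sinc l) sequentially" if "f \<longlonglongrightarrow> l" for f l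
    using isCont_tendsto_compose[OF isCont_sinc that] .
  have inv: "(\<lambda>m. 1 / (2 * real m)) \<longlonglongrightarrow> 0"
    using tendsto_mult[OF tendsto_const[of "1 / 2"] lim_inverse_n] by (simp add: inverse_eq_divide)
  have half: "(\<lambda>m. sinc (d m / 2)) \<longlonglongrightarrow> 1"
    using sinc[of "\<lambda>m. d m / 2" 0] tendsto_divide[OF d0 tendsto_const[of 2]] by simp
  have "(\<lambda>m. real m * d m + d m / 2) \<longlonglongrightarrow> \<tau> + 0 / 2"
    by (intro tendsto_intros assms d0) simp
  then have full: "(\<lambda>m. sinc ((real m + 1 / 2) * d m)) \<longlonglongrightarrow> sinc \<tau>"
    by (intro sinc) (simp add: distrib_right)
  have "(\<lambda>m. ((1 + 1 / (2 * real m)) * sinc ((real m + 1 / 2) * d m) - 1 / (2 * real m) * sinc (d m / 2))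
      / sinc (d m / 2)) \<longlonglongrightarrow> ((1 + 0) * sinc \<tau> - 0 * 1) / 1"
    by (intro tendsto_divide tendsto_diff tendsto_mult tendsto_add tendsto_const inv half full) simp
  moreover have "\<forall>\<^sub>F m in sequentially. ((1 + 1 / (2 * real m)) * sinc ((real m + 1 / 2) * d m)
      - 1 / (2 * real m) * sinc (d m / 2)) / sinc (d m / 2) = (\<Sum>n<m. cos (real (Suc n) * d m)) / real m"
    using eventually_gt_at_top[of 0] order_tendstoD(1)[OF half zero_less_one]
  proof eventually_elim
    case (elim m)
    have "sinc (d m / 2) \<noteq> 0" using less_imp_neq[OF elim(2)] by (rule not_sym)
    then show ?case
      unfolding sum_cos_sinc[OF elim(1), symmetric] by (rule nonzero_mult_div_cancel_left)
  qed
  ultimately show ?thesis by (simp only: tendsto_cong) simp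
qed

text \<open>Away from resonance the geometric sums stay bounded. This is applied to the sum of two
  angles, whose limit is twice the base angle.\<close>

lemma mean_cis_tendsto_0:
  assumes "\<phi> \<longlonglongrightarrow> \<phi>0" "cis \<phi>0 \<noteq> 1"
  shows "(\<lambda>m. cmod (\<Sum>n<m. cis (real (Suc n) * \<phi> m)) / real m) \<longlonglongrightarrow> 0"
proof (rule tendsto_sandwich[OF _ _ tendsto_const])
  have cis: "(\<lambda>m. cis (\<phi> m)) \<longlonglongrightarrow> cis \<phi>0" by (intro tendsto_cis assms)
  then have "(\<lambda>m. 2 / cmod (1 - cis (\<phi> m)) * inverse (real m)) \<longlonglongrightarrow> 2 / cmod (1 - cis \<phi>0) * 0"
    using assms(2)
    by (intro tendsto_mult tendsto_divide tendsto_const tendsto_norm tendsto_diff cis lim_inverse_n) auto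
  then show "(\<lambda>m. 2 / cmod (1 - cis (\<phi> m)) * inverse (real m)) \<longlonglongrightarrow> 0" by simp
  have "\<forall>\<^sub>F m in sequentially. cis (\<phi> m) \<noteq> 1"
    using tendsto_imp_eventually_ne[OF cis assms(2)] .
  then show "\<forall>\<^sub>F m in sequentially. cmod (\<Sum>n<m. cis (real (Suc n) * \<phi> m)) / real m
      \<le> 2 / cmod (1 - cis (\<phi> m)) * inverse (real m)"
  proof eventually_elim
    case (elim m)
    let ?z = "cis (\<phi> m)"
    have "(\<Sum>n<m. cis (real (Suc n) * \<phi> m)) = ?z * (\<Sum>n<m. ?z ^ n)"
      unfolding sum_distrib_left
      by (rule sum.cong) (simp_all only: Complex.DeMoivre cis_mult distrib_right of_nat_Suc mult_1 refl)
    also have "\<dots> = ?z * ((1 - ?z ^ m) / (1 - ?z))"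
      using elim by (simp add: sum_gp_strict)
    also have "cmod \<dots> = cmod (1 - ?z ^ m) / cmod (1 - ?z)"
      by (simp add: norm_mult norm_divide)
    also have "\<dots> \<le> 2 / cmod (1 - ?z)"
      using norm_triangle_ineq4[of 1 "?z ^ m"] by (intro divide_right_mono) (auto simp: norm_power)
    finally show ?case by (simp add: divide_inverse mult_right_mono)
  qed
qed simp

section \<open>Averaged products under mean-square perturbation\<close>

lemma mean_abs_tendsto_0:
  fixes d :: "nat \<Rightarrow> nat \<Rightarrow> real"
  assumes "(\<lambda>m. (\<Sum>n<m. (d m n)\<^sup>2) / real m) \<longlonglongrightarrow> 0"
  shows "(\<lambda>m. (\<Sum>n<m. \<bar>d m n\<bar>) / real m) \<longlonglongrightarrow> 0"
proof (rule tendsto_sandwich[OF _ _ tendsto_const])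
  show "(\<lambda>m. sqrt ((\<Sum>n<m. (d m n)\<^sup>2) / real m)) \<longlonglongrightarrow> 0"
    using tendsto_real_sqrt[OF assms] by simp
  show "\<forall>\<^sub>F m in sequentially. (\<Sum>n<m. \<bar>d m n\<bar>) / real m \<le> sqrt ((\<Sum>n<m. (d m n)\<^sup>2) / real m)"
    using eventually_gt_at_top[of 0]
  proof eventually_elim
    case (elim m)
    have "(\<Sum>n<m. \<bar>d m n\<bar>)\<^sup>2 \<le> (\<Sum>n<m. \<bar>d m n\<bar>\<^sup>2) * card {..<m}"
      by (rule sum_squared_le_sum_of_squares)
    then have "((\<Sum>n<m. \<bar>d m n\<bar>) / real m)\<^sup>2 \<le> (\<Sum>n<m. (d m n)\<^sup>2) / real m"
      using elim by (simp add: power_divide divide_simps power2_eq_square)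
    then show ?case by (rule real_le_rsqrt)
  qed
qed (simp add: sum_nonneg)

text \<open>Expand the product around \<open>X0\<close> and \<open>Y0\<close>: the linear terms need
  boundedness of the reference factors only and are small by Cauchy-Schwarz, while the quadratic
  term is below the sum of the two squares. So \<open>X\<close> and \<open>Y\<close> may have large
  exceptional terms.\<close>

lemma mean_product_tendsto:
  fixes X Y X0 Y0 :: "nat \<Rightarrow> nat \<Rightarrow> real"
  assumes bd: "\<And>m n. \<bar>X0 m n\<bar> \<le> 1" "\<And>m n. \<bar>Y0 m n\<bar> \<le> 1"
    and X: "(\<lambda>m. (\<Sum>n<m. (X m n - X0 m n)\<^sup>2) / real m) \<longlonglongrightarrow> 0"
    and Y: "(\<lambda>m. (\<Sum>n<m. (Y m n - Y0 m n)\<^sup>2) / real m) \<longlonglongrightarrow> 0"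
    and L: "(\<lambda>m. (\<Sum>n<m. X0 m n * Y0 m n) / real m) \<longlonglongrightarrow> L"
  shows "(\<lambda>m. (\<Sum>n<m. X m n * Y m n) / real m) \<longlonglongrightarrow> L"
proof -
  let ?dX = "\<lambda>m n. X m n - X0 m n" and ?dY = "\<lambda>m n. Y m n - Y0 m n"
  have "(\<lambda>m. (\<Sum>n<m. X m n * Y m n) / real m - (\<Sum>n<m. X0 m n * Y0 m n) / real m) \<longlonglongrightarrow> 0"
  proof (rule Lim_null_comparison)
    show "(\<lambda>m. (\<Sum>n<m. \<bar>?dX m n\<bar>) / real m + (\<Sum>n<m. \<bar>?dY m n\<bar>) / real m
        + ((\<Sum>n<m. (?dX m n)\<^sup>2) / real m + (\<Sum>n<m. (?dY m n)\<^sup>2) / real m)) \<longlonglongrightarrow> 0"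
      by (intro tendsto_add_zero mean_abs_tendsto_0 X Y)
    show "\<forall>\<^sub>F m in sequentially. norm ((\<Sum>n<m. X m n * Y m n) / real m - (\<Sum>n<m. X0 m n * Y0 m n) / real m)
        \<le> (\<Sum>n<m. \<bar>?dX m n\<bar>) / real m + (\<Sum>n<m. \<bar>?dY m n\<bar>) / real m
        + ((\<Sum>n<m. (?dX m n)\<^sup>2) / real m + (\<Sum>n<m. (?dY m n)\<^sup>2) / real m)"
    proof (intro always_eventually allI)
      fix m
      have ptw: "\<bar>X m n * Y m n - X0 m n * Y0 m n\<bar> \<le> \<bar>?dX m n\<bar> + \<bar>?dY m n\<bar> + ((?dX m n)\<^sup>2 + (?dY m n)\<^sup>2)" for n
      proof -
        have "X m n * Y m n - X0 m n * Y0 m n = ?dX m n * Y0 m n + X0 m n * ?dY m n + ?dX m n * ?dY m n"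
          by (simp add: algebra_simps)
        then have "\<bar>X m n * Y m n - X0 m n * Y0 m n\<bar>
            \<le> \<bar>?dX m n\<bar> * \<bar>Y0 m n\<bar> + \<bar>X0 m n\<bar> * \<bar>?dY m n\<bar> + \<bar>?dX m n\<bar> * \<bar>?dY m n\<bar>"
          by (simp only: abs_mult[symmetric])
        moreover have "\<bar>?dX m n\<bar> * \<bar>Y0 m n\<bar> \<le> \<bar>?dX m n\<bar>" "\<bar>X0 m n\<bar> * \<bar>?dY m n\<bar> \<le> \<bar>?dY m n\<bar>"
          using bd by (simp_all add: mult_left_le mult_left_le_one_le)
        moreover have "2 * (\<bar>?dX m n\<bar> * \<bar>?dY m n\<bar>) \<le> (?dX m n)\<^sup>2 + (?dY m n)\<^sup>2"
          using sum_squares_bound[of "\<bar>?dX m n\<bar>" "\<bar>?dY m n\<bar>"] by simp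
        moreover have "0 \<le> \<bar>?dX m n\<bar> * \<bar>?dY m n\<bar>" by simp
        ultimately show ?thesis by linarith
      qed
      have "\<bar>(\<Sum>n<m. X m n * Y m n) - (\<Sum>n<m. X0 m n * Y0 m n)\<bar>
          \<le> (\<Sum>n<m. \<bar>?dX m n\<bar> + \<bar>?dY m n\<bar> + ((?dX m n)\<^sup>2 + (?dY m n)\<^sup>2))"
        unfolding sum_subtractf[symmetric] by (rule order_trans[OF sum_abs sum_mono]) (rule ptw)
      then show "norm ((\<Sum>n<m. X m n * Y m n) / real m - (\<Sum>n<m. X0 m n * Y0 m n) / real m)
          \<le> (\<Sum>n<m. \<bar>?dX m n\<bar>) / real m + (\<Sum>n<m. \<bar>?dY m n\<bar>) / real m
        + ((\<Sum>n<m. (?dX m n)\<^sup>2) / real m + (\<Sum>n<m. (?dY m n)\<^sup>2) / real m)"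
        unfolding diff_divide_distrib[symmetric] add_divide_distrib[symmetric] sum.distrib[symmetric]
        by (simp add: divide_right_mono)
    qed
  qed
  from tendsto_add[OF this L] show ?thesis by simp
qed

section \<open>Averages of Pruefer products\<close>

text \<open>The comparison passes through the value at index \<open>n\<close> and angle
  \<open>t0\<close>. Changing the angle costs the relative error \<open>e m\<close>, an
  \<open>o(m)\<close> Lipschitz bound times an angle difference of order \<open>1 / m\<close>;
  changing the index costs \<open>G m / m\<close> in mean square. Monotonicity of \<open>A\<close>
  makes the first bound uniform over \<open>n < m\<close>.\<close>

lemma prufer_mean_deviation_tendsto_0:
  assumes B: "\<And>n. \<bar>b (Suc n)\<bar> \<le> B"
    and sub: "\<And>q c. q \<ge> 1 \<Longrightarrow> c \<ge> 0 \<Longrightarrow> (\<lambda>n. sparse_bound q c b n / real n) \<longlonglongrightarrow> 0"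
    and t0: "sin t0 > 0" and t: "(\<lambda>m. real m * (t m - t0)) \<longlonglongrightarrow> \<alpha>"
  shows "(\<lambda>m. (\<Sum>n<m. (cmod (prufer b (t m) n - prufer b t0 m) / cmod (prufer b t0 m))\<^sup>2) / real m) \<longlonglongrightarrow> 0"
proof -
  \<comment> \<open>The 2 leaves room for the angles \<open>t m\<close>, whose sine eventually
    exceeds \<open>sin t0 / 2\<close>.\<close>
  define s where "s = 2 / sin t0"
  have "s > 0" using t0 by (simp add: s_def)
  have "B \<ge> 0" using B[of 0] by linarith
  have s0: "1 \<le> s * sin t0" using t0 by (simp add: s_def)
  define q where "q = 1 + s * B"
  have "q \<ge> 1" using \<open>s > 0\<close> \<open>B \<ge> 0\<close> by (simp add: q_def)
  then have "q\<^sup>2 \<ge> 1" by (simp add: one_le_power)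
  define A where "A = sparse_bound (q\<^sup>2) ((s\<^sup>2 + 2 * s) * q) b"
  define G where "G = sparse_bound (2 * q\<^sup>2) (2 * s\<^sup>2 * B * q\<^sup>2) b"
  have A_mono: "mono A"
    unfolding A_def using \<open>q\<^sup>2 \<ge> 1\<close> \<open>q \<ge> 1\<close> \<open>s > 0\<close> by (intro sparse_bound_mono) auto
  have A_lim: "(\<lambda>m. A m / real m) \<longlonglongrightarrow> 0"
    unfolding A_def using \<open>q\<^sup>2 \<ge> 1\<close> \<open>q \<ge> 1\<close> \<open>s > 0\<close> by (intro sub) auto
  have G_lim: "(\<lambda>m. G m / real m) \<longlonglongrightarrow> 0"
    unfolding G_def using \<open>q\<^sup>2 \<ge> 1\<close> \<open>B \<ge> 0\<close> by (intro sub) auto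
  define e where "e m = A m * \<bar>t m - t0\<bar>" for m
  have e_lim: "e \<longlonglongrightarrow> 0"
  proof -
    have "(\<lambda>m. A m / real m * \<bar>real m * (t m - t0)\<bar>) \<longlonglongrightarrow> 0 * \<bar>\<alpha>\<bar>"
      by (intro tendsto_intros A_lim t)
    moreover have "\<forall>\<^sub>F m in sequentially. A m / real m * \<bar>real m * (t m - t0)\<bar> = e m"
      using eventually_gt_at_top[of 0] by eventually_elim (simp add: e_def abs_mult)
    ultimately show ?thesis by (simp add: tendsto_cong)
  qed
  have "(\<lambda>m. sin (t m)) \<longlonglongrightarrow> sin t0" by (intro tendsto_sin angle_tendsto[OF t])
  then have ev: "\<forall>\<^sub>F m in sequentially. sin t0 / 2 < sin (t m)"
    by (rule order_tendstoD(1)) (use t0 in simp)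
  show ?thesis
  proof (rule tendsto_sandwich[OF _ _ tendsto_const])
    have "(\<lambda>m. (4 * (e m)\<^sup>2 + 2) * (G m / real m) + 4 * (e m)\<^sup>2) \<longlonglongrightarrow> (4 * 0\<^sup>2 + 2) * 0 + 4 * 0\<^sup>2"
      by (intro tendsto_intros e_lim G_lim)
    then show "(\<lambda>m. (4 * (e m)\<^sup>2 + 2) * (G m / real m) + 4 * (e m)\<^sup>2) \<longlonglongrightarrow> 0" by simp
    show "\<forall>\<^sub>F m in sequentially. (\<Sum>n<m. (cmod (prufer b (t m) n - prufer b t0 m) / cmod (prufer b t0 m))\<^sup>2) / real m
        \<le> (4 * (e m)\<^sup>2 + 2) * (G m / real m) + 4 * (e m)\<^sup>2"
      using ev eventually_gt_at_top[of 0]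
    proof eventually_elim
      case (elim m)
      let ?w = "prufer b t0" and ?w' = "prufer b (t m)"
      have sm: "1 \<le> s * sin (t m)" using elim t0 by (simp add: s_def field_simps)
      have sq: "(x + y)\<^sup>2 \<le> 2 * x\<^sup>2 + 2 * y\<^sup>2" for x y :: real
        using sum_squares_bound[of x y] by (simp add: power2_sum)
      \<comment> \<open>The square inequality is used twice: to split the path at the intermediate
        value, and to bound that value by its deviation from the reference plus the
        reference.\<close>
      have ptw: "(cmod (?w' n - ?w m))\<^sup>2 \<le> (4 * (e m)\<^sup>2 + 2) * (cmod (?w n - ?w m))\<^sup>2 + 4 * (e m)\<^sup>2 * (cmod (?w m))\<^sup>2"
        if "n < m" for n
      proof -
        have "cmod (?w' n - ?w n) \<le> A n * \<bar>t m - t0\<bar> * cmod (?w n)"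
          unfolding A_def q_def by (intro prufer_angle_dependence s0 sm B \<open>s > 0\<close>)
        also have "\<dots> \<le> e m * cmod (?w n)"
          unfolding e_def using monoD[OF A_mono, of n m] that by (intro mult_right_mono) auto
        finally have "(cmod (?w' n - ?w n))\<^sup>2 \<le> (e m)\<^sup>2 * (cmod (?w n))\<^sup>2"
          unfolding power_mult_distrib[symmetric] by (intro power_mono) auto
        moreover have "(cmod (?w n))\<^sup>2 \<le> 2 * (cmod (?w n - ?w m))\<^sup>2 + 2 * (cmod (?w m))\<^sup>2"
          using order_trans[OF power_mono[OF norm_triangle_ineq[of "?w n - ?w m" "?w m"] norm_ge_zero] sq] by simp
        then have "(e m)\<^sup>2 * (cmod (?w n))\<^sup>2 \<le> (e m)\<^sup>2 * (2 * (cmod (?w n - ?w m))\<^sup>2 + 2 * (cmod (?w m))\<^sup>2)"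
          by (rule mult_left_mono) simp
        moreover have "(cmod (?w' n - ?w m))\<^sup>2 \<le> 2 * (cmod (?w' n - ?w n))\<^sup>2 + 2 * (cmod (?w n - ?w m))\<^sup>2"
          using order_trans[OF power_mono[OF norm_triangle_ineq[of "?w' n - ?w n" "?w n - ?w m"] norm_ge_zero] sq] by simp
        ultimately show ?thesis by (simp add: algebra_simps)
      qed
      have "(\<Sum>n<m. (cmod (?w' n - ?w m))\<^sup>2)
          \<le> (\<Sum>n<m. (4 * (e m)\<^sup>2 + 2) * (cmod (?w n - ?w m))\<^sup>2 + 4 * (e m)\<^sup>2 * (cmod (?w m))\<^sup>2)"
        by (intro sum_mono ptw) simp
      also have "\<dots> = (4 * (e m)\<^sup>2 + 2) * (\<Sum>n<m. (cmod (?w n - ?w m))\<^sup>2) + real m * (4 * (e m)\<^sup>2 * (cmod (?w m))\<^sup>2)"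
        by (simp add: sum.distrib sum_distrib_left)
      also have "\<dots> \<le> (4 * (e m)\<^sup>2 + 2) * (G m * (cmod (?w m))\<^sup>2) + real m * (4 * (e m)\<^sup>2 * (cmod (?w m))\<^sup>2)"
        unfolding G_def q_def using s0 t0
        by (intro add_right_mono mult_left_mono prufer_mean_square_deviation B) auto
      also have "\<dots> = ((4 * (e m)\<^sup>2 + 2) * G m + 4 * (e m)\<^sup>2 * real m) * (cmod (?w m))\<^sup>2"
        by (simp add: algebra_simps)
      finally have "(\<Sum>n<m. (cmod (?w' n - ?w m))\<^sup>2) / (cmod (?w m))\<^sup>2 \<le> (4 * (e m)\<^sup>2 + 2) * G m + 4 * (e m)\<^sup>2 * real m"
        using cmod_prufer_pos[of b t0 m] by (simp add: divide_le_eq)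
      then have "(\<Sum>n<m. (cmod (?w' n - ?w m) / cmod (?w m))\<^sup>2) \<le> (4 * (e m)\<^sup>2 + 2) * G m + 4 * (e m)\<^sup>2 * real m"
        by (simp add: power_divide sum_divide_distrib)
      from divide_right_mono[OF this, of "real m"] show ?case
        using elim(2) by (simp add: add_divide_distrib)
    qed
  qed (simp add: sum_nonneg)
qed

text \<open>A product of imaginary parts is half the difference of \<open>Re (p * cnj q)\<close> and
  \<open>Re (p * q)\<close>. The unit factor cancels in the first, leaving the cosine of the angle
  difference; in the second it is pulled out of a sum that averages to 0. Hence \<open>U m\<close>
  may vary arbitrarily with \<open>m\<close>.\<close>

lemma mean_Im_product_tendsto:
  fixes ta tb :: "nat \<Rightarrow> real" and U :: "nat \<Rightarrow> complex"
  assumes t0: "sin t0 \<noteq> 0" and U: "\<And>m. cmod (U m) = 1"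
    and ta: "(\<lambda>m. real m * (ta m - t0)) \<longlonglongrightarrow> \<alpha>" and tb: "(\<lambda>m. real m * (tb m - t0)) \<longlonglongrightarrow> \<beta>"
  shows "(\<lambda>m. (\<Sum>n<m. Im (cis (real (Suc n) * ta m) * U m) * Im (cis (real (Suc n) * tb m) * U m)) / real m)
      \<longlonglongrightarrow> sinc (\<alpha> - \<beta>) / 2"
proof -
  have diff: "(\<lambda>m. real m * (ta m - tb m)) \<longlonglongrightarrow> \<alpha> - \<beta>"
    using tendsto_diff[OF ta tb] by (simp add: algebra_simps)
  have "cis (t0 + t0) \<noteq> 1"
  proof
    assume "cis (t0 + t0) = 1"
    then have "cos (2 * t0) = 1" by (simp add: complex_eq_iff)
    then show False using t0 by (simp add: cos_double_sin)
  qed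
  then have sum: "(\<lambda>m. cmod (\<Sum>n<m. cis (real (Suc n) * (ta m + tb m))) / real m) \<longlonglongrightarrow> 0"
    by (intro mean_cis_tendsto_0[of _ "t0 + t0"] tendsto_add angle_tendsto[OF ta] angle_tendsto[OF tb])
  have osc: "(\<lambda>m. Re ((U m)\<^sup>2 * (\<Sum>n<m. cis (real (Suc n) * (ta m + tb m)))) / real m) \<longlonglongrightarrow> 0"
  proof (rule Lim_null_comparison[OF _ sum], intro always_eventually allI)
    fix m
    have "\<bar>Re ((U m)\<^sup>2 * (\<Sum>n<m. cis (real (Suc n) * (ta m + tb m))))\<bar> \<le> cmod (\<Sum>n<m. cis (real (Suc n) * (ta m + tb m)))"
      using abs_Re_le_cmod[of "(U m)\<^sup>2 * (\<Sum>n<m. cis (real (Suc n) * (ta m + tb m)))"]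
      unfolding norm_mult norm_power U by simp
    then show "norm (Re ((U m)\<^sup>2 * (\<Sum>n<m. cis (real (Suc n) * (ta m + tb m)))) / real m)
        \<le> cmod (\<Sum>n<m. cis (real (Suc n) * (ta m + tb m))) / real m"
      by (simp add: divide_right_mono del: Re_sum times_complex.sel)
  qed
  have Im_prod: "Im p * Im q = Re (p * cnj q) / 2 - Re (p * q) / 2" for p q by (simp add: field_simps)
  have summand: "Im (cis (real (Suc n) * ta m) * U m) * Im (cis (real (Suc n) * tb m) * U m)
      = cos (real (Suc n) * (ta m - tb m)) / 2 - Re ((U m)\<^sup>2 * cis (real (Suc n) * (ta m + tb m))) / 2" for m n
  proof -
    let ?x = "real (Suc n) * ta m" and ?y = "real (Suc n) * tb m"
    have "(cis ?x * U m) * cnj (cis ?y * U m) = (cis ?x * cis (- ?y)) * (U m * cnj (U m))"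
      by (simp only: complex_cnj_mult cis_cnj mult_ac)
    also have "U m * cnj (U m) = 1"
      using U[of m] by (simp add: complex_norm_square[symmetric])
    also have "cis ?x * cis (- ?y) * 1 = cis (real (Suc n) * (ta m - tb m))"
      by (simp add: cis_mult right_diff_distrib)
    finally have 1: "(cis ?x * U m) * cnj (cis ?y * U m) = cis (real (Suc n) * (ta m - tb m))" .
    have "(cis ?x * U m) * (cis ?y * U m) = (U m)\<^sup>2 * (cis ?x * cis ?y)"
      by (simp only: power2_eq_square mult_ac)
    also have "cis ?x * cis ?y = cis (real (Suc n) * (ta m + tb m))"
      by (simp add: cis_mult distrib_left)
    finally have 2: "(cis ?x * U m) * (cis ?y * U m) = (U m)\<^sup>2 * cis (real (Suc n) * (ta m + tb m))" .
    show ?thesis unfolding Im_prod 1 2 by simp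
  qed
  have "(\<lambda>m. (\<Sum>n<m. cos (real (Suc n) * (ta m - tb m))) / real m / 2
      - Re ((U m)\<^sup>2 * (\<Sum>n<m. cis (real (Suc n) * (ta m + tb m)))) / real m / 2) \<longlonglongrightarrow> sinc (\<alpha> - \<beta>) / 2 - 0 / 2"
    by (intro tendsto_diff tendsto_divide tendsto_const mean_cos_tendsto_sinc[OF diff] osc) simp_all
  moreover have "(\<Sum>n<m. Im (cis (real (Suc n) * ta m) * U m) * Im (cis (real (Suc n) * tb m) * U m)) / real m
      = (\<Sum>n<m. cos (real (Suc n) * (ta m - tb m))) / real m / 2
        - Re ((U m)\<^sup>2 * (\<Sum>n<m. cis (real (Suc n) * (ta m + tb m)))) / real m / 2" for m
    unfolding summand sum_subtractf sum_divide_distrib[symmetric] sum_distrib_left Re_sum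
    by (simp add: diff_divide_distrib mult.commute)
  ultimately show ?thesis by (simp only: div_0 diff_zero)
qed

text \<open>Dividing by the modulus of the reference value makes the comparison terms bounded by 1
  and reduces that value to a unit phase.\<close>

lemma prufer_mean_product_tendsto:
  fixes ta tb :: "nat \<Rightarrow> real"
  assumes B: "\<And>n. \<bar>b (Suc n)\<bar> \<le> B"
    and sub: "\<And>q c. q \<ge> 1 \<Longrightarrow> c \<ge> 0 \<Longrightarrow> (\<lambda>n. sparse_bound q c b n / real n) \<longlonglongrightarrow> 0"
    and t0: "sin t0 > 0"
    and ta: "(\<lambda>m. real m * (ta m - t0)) \<longlonglongrightarrow> \<alpha>" and tb: "(\<lambda>m. real m * (tb m - t0)) \<longlonglongrightarrow> \<beta>"
  shows "(\<lambda>m. (\<Sum>n<m. Im (cis (real (Suc n) * ta m) * prufer b (ta m) n)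
        * Im (cis (real (Suc n) * tb m) * prufer b (tb m) n)) / (real m * (cmod (prufer b t0 m))\<^sup>2))
      \<longlonglongrightarrow> sinc (\<alpha> - \<beta>) / 2"
proof -
  define W where "W = prufer b t0"
  define X where "X t m n = Im (cis (real (Suc n) * t m) * prufer b (t m) n) / cmod (W m)" for t :: "nat \<Rightarrow> real" and m n
  define X0 where "X0 t m n = Im (cis (real (Suc n) * t m) * (W m / of_real (cmod (W m))))" for t :: "nat \<Rightarrow> real" and m n
  have pos: "cmod (W m) > 0" for m unfolding W_def by (rule cmod_prufer_pos)
  have bd: "\<bar>X0 t m n\<bar> \<le> 1" for t m n
    unfolding X0_def using cmod_Im_cis_le[of "real (Suc n) * t m" "W m / of_real (cmod (W m))"] pos[of m]
    by (simp add: norm_divide del: times_complex.sel)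
  have dev: "(\<lambda>m. (\<Sum>n<m. (X t m n - X0 t m n)\<^sup>2) / real m) \<longlonglongrightarrow> 0"
    if "(\<lambda>m. real m * (t m - t0)) \<longlonglongrightarrow> \<gamma>" for t \<gamma>
  proof (rule tendsto_sandwich[OF _ _ tendsto_const])
    show "(\<lambda>m. (\<Sum>n<m. (cmod (prufer b (t m) n - W m) / cmod (W m))\<^sup>2) / real m) \<longlonglongrightarrow> 0"
      unfolding W_def by (rule prufer_mean_deviation_tendsto_0[OF B sub t0 that])
    have "(X t m n - X0 t m n)\<^sup>2 \<le> (cmod (prufer b (t m) n - W m) / cmod (W m))\<^sup>2" for m n
    proof -
      let ?c = "cis (real (Suc n) * t m)" and ?r = "cmod (W m)"
      have "?c * (W m / of_real ?r) = (?c * W m) / of_real ?r" by simp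
      then have "X0 t m n = Im (?c * W m) / ?r"
        unfolding X0_def by (simp only: Im_divide_of_real)
      then have "X t m n - X0 t m n = Im (?c * (prufer b (t m) n - W m)) / ?r"
        unfolding X_def by (simp only: diff_divide_distrib[symmetric] minus_complex.sel[symmetric] right_diff_distrib)
      then have "\<bar>X t m n - X0 t m n\<bar> = \<bar>Im (?c * (prufer b (t m) n - W m))\<bar> / ?r"
        by (simp only: abs_divide abs_norm_cancel)
      also have "\<dots> \<le> cmod (prufer b (t m) n - W m) / ?r"
        by (intro divide_right_mono cmod_Im_cis_le) simp
      finally show ?thesis using power_mono[OF _ abs_ge_zero, of "X t m n - X0 t m n" _ 2] by simp
    qed
    then show "\<forall>\<^sub>F m in sequentially. (\<Sum>n<m. (X t m n - X0 t m n)\<^sup>2) / real m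
        \<le> (\<Sum>n<m. (cmod (prufer b (t m) n - W m) / cmod (W m))\<^sup>2) / real m"
      by (intro always_eventually allI divide_right_mono sum_mono) auto
  qed (simp add: sum_nonneg)
  have main: "(\<lambda>m. (\<Sum>n<m. X0 ta m n * X0 tb m n) / real m) \<longlonglongrightarrow> sinc (\<alpha> - \<beta>) / 2"
    unfolding X0_def
    by (rule mean_Im_product_tendsto[OF _ _ ta tb]) (use t0 pos in \<open>auto simp: norm_divide less_imp_neq\<close>)
  have "(\<lambda>m. (\<Sum>n<m. X ta m n * X tb m n) / real m) \<longlonglongrightarrow> sinc (\<alpha> - \<beta>) / 2"
    by (rule mean_product_tendsto[OF bd bd dev[OF ta] dev[OF tb] main])
  then show ?thesis
    unfolding X_def W_def
    by (simp only: times_divide_times_eq sum_divide_distrib[symmetric] power2_eq_square divide_divide_eq_left mult.commute)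
qed

section \<open>The kernel in Pruefer variables and the limit\<close>

lemma CD_kernel_eq_prufer:
  assumes "jacobi_measure (\<lambda>_. 1) b \<mu>" "\<bar>y\<bar> < 2" "\<bar>z\<bar> < 2"
  shows "CD_kernel \<mu> m y z = (\<Sum>n<m. Im (cis (real (Suc n) * arccos (y / 2)) * prufer b (arccos (y / 2)) n)
      * Im (cis (real (Suc n) * arccos (z / 2)) * prufer b (arccos (z / 2)) n))
      / (sin (arccos (y / 2)) * sin (arccos (z / 2)))"
proof -
  have eq: "poly (jacobi_poly (\<lambda>_. 1) b n) x
      = Im (cis (real (Suc n) * arccos (x / 2)) * prufer b (arccos (x / 2)) n) / sin (arccos (x / 2))"
    if "\<bar>x\<bar> < 2" for x n
  proof -
    have "sin (arccos (x / 2)) \<noteq> 0" using that by (intro sin_arccos_nonzero) auto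
    from jacobi_poly_eq_prufer[OF this, of b n] show ?thesis
      using that by (simp add: cos_arccos abs_if split: if_splits)
  qed
  show ?thesis
    unfolding CD_kernel_def orthonormal_poly_eq_jacobi_poly[OF assms(1) zero_less_one]
      eq[OF assms(2)] eq[OF assms(3)] times_divide_times_eq sum_divide_distrib ..
qed

text \<open>Numerator and denominator are both referred to the base angle of \<open>x\<close>, so
  the normaliser \<open>real m * (cmod (prufer b (T x) m))^2\<close> cancels. The diagonal kernel is
  the case of zero shifts, with nonzero limit \<open>1 / 2\<close>; the sine prefactors agree in the
  limit.\<close>

lemma sine_kernel_limit:
  assumes \<mu>: "jacobi_measure (\<lambda>_. 1) b \<mu>" and B: "\<And>n. \<bar>b (Suc n)\<bar> \<le> B"
    and sub: "\<And>q c. q \<ge> 1 \<Longrightarrow> c \<ge> 0 \<Longrightarrow> (\<lambda>n. sparse_bound q c b n / real n) \<longlonglongrightarrow> 0"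
    and x: "\<bar>x\<bar> < 2"
  shows "(\<lambda>n. CD_kernel \<mu> n (x + c / real n) (x + d / real n) / CD_kernel \<mu> n x x)
      \<longlonglongrightarrow> sinc ((d - c) / sqrt (4 - x\<^sup>2))"
proof -
  define T where "T y = arccos (y / 2)" for y :: real
  define t where "t e m = T (x + e / real m)" for e and m :: nat
  define M where "M e f m = (\<Sum>n<m. Im (cis (real (Suc n) * t e m) * prufer b (t e m) n)
        * Im (cis (real (Suc n) * t f m) * prufer b (t f m) n)) / (real m * (cmod (prufer b (T x) m))\<^sup>2)" for e f m
  have sin_pos: "sin (T x) > 0"
    unfolding T_def using x by (subst sin_arccos) (auto simp: abs_square_less_1)
  have lim: "(\<lambda>m. real m * (t e m - T x)) \<longlonglongrightarrow> - e / sqrt (4 - x\<^sup>2)" for e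
    unfolding t_def T_def using x by (intro arccos_half_shift_tendsto) auto
  have M: "M e f \<longlonglongrightarrow> sinc ((f - e) / sqrt (4 - x\<^sup>2)) / 2" for e f
  proof -
    have eq: "- e / r - - f / r = (f - e) / r" for r by (simp add: diff_divide_distrib)
    show ?thesis
      using prufer_mean_product_tendsto[OF B sub sin_pos lim lim, of e f] unfolding M_def eq .
  qed
  have sin_lim: "(\<lambda>m. sin (t e m)) \<longlonglongrightarrow> sin (T x)" for e
    by (intro tendsto_sin angle_tendsto[OF lim])
  have "(\<lambda>m. M c d m / M 0 0 m * ((sin (T x) * sin (T x)) / (sin (t c m) * sin (t d m))))
      \<longlonglongrightarrow> (sinc ((d - c) / sqrt (4 - x\<^sup>2)) / 2) / (sinc ((0 - 0) / sqrt (4 - x\<^sup>2)) / 2)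
        * ((sin (T x) * sin (T x)) / (sin (T x) * sin (T x)))"
    using sin_pos by (intro tendsto_mult tendsto_divide M sin_lim tendsto_const) auto
  then have "(\<lambda>m. M c d m / M 0 0 m * ((sin (T x) * sin (T x)) / (sin (t c m) * sin (t d m))))
      \<longlonglongrightarrow> sinc ((d - c) / sqrt (4 - x\<^sup>2))"
    using sin_pos by simp
  moreover have "\<forall>\<^sub>F m in sequentially. M c d m / M 0 0 m * ((sin (T x) * sin (T x)) / (sin (t c m) * sin (t d m)))
      = CD_kernel \<mu> m (x + c / real m) (x + d / real m) / CD_kernel \<mu> m x x"
  proof -
    have small: "\<forall>\<^sub>F m in sequentially. \<bar>x + e / real m\<bar> < 2" for e
    proof -
      have "(\<lambda>m. \<bar>x + e * inverse (real m)\<bar>) \<longlonglongrightarrow> \<bar>x + e * 0\<bar>"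
        by (intro tendsto_intros lim_inverse_n)
      then show ?thesis
        using order_tendstoD(2)[of _ "\<bar>x\<bar>" _ 2] x by (simp add: divide_inverse)
    qed
    show ?thesis
      using eventually_gt_at_top[of 0] small[of c] small[of d]
    proof eventually_elim
      case (elim m)
      let ?k = "real m * (cmod (prufer b (T x) m))\<^sup>2"
      have "?k \<noteq> 0" using elim(1) cmod_prufer_pos[of b "T x" m] by simp
      have K: "CD_kernel \<mu> m (x + e / real m) (x + f / real m) = M e f m * ?k / (sin (t e m) * sin (t f m))"
        if "\<bar>x + e / real m\<bar> < 2" "\<bar>x + f / real m\<bar> < 2" for e f
        unfolding CD_kernel_eq_prufer[OF \<mu> that] M_def t_def T_def using \<open>?k \<noteq> 0\<close> unfolding T_def by simp
      have K0: "CD_kernel \<mu> m x x = M 0 0 m * ?k / (sin (T x) * sin (T x))"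
        using K[of 0 0] x by (simp add: t_def)
      show ?case
        unfolding K[OF elim(2,3)] K0 using \<open>?k \<noteq> 0\<close> by simp
    qed
  qed
  ultimately show ?thesis by (rule Lim_transform_eventually)
qed

theorem theorem1p1:
  fixes v :: "nat \<Rightarrow> real"
  assumes "v \<longlonglongrightarrow> 0"
  shows "\<exists>Nt :: nat \<Rightarrow> nat list \<Rightarrow> nat.
    \<forall>N :: nat \<Rightarrow> nat.
      (\<forall>j\<ge>1. N j > 0) \<and> strict_mono_on {1..} N \<and>
      filterlim (\<lambda>j. real (N (j + 1)) / real (N j)) at_top sequentially \<and>
      (\<forall>k\<ge>1. N (k + 1) \<ge> Nt k (map N [1..<k + 1])) \<longrightarrow>
      (\<forall>\<mu> :: real measure. jacobi_measure (\<lambda>n. 1) (sparse_potential v N) \<mu> \<longrightarrow>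
        (\<forall>x\<in>{-2<..<2}. \<forall>a b :: real.
          (\<lambda>n. CD_kernel \<mu> n (x + a / real n) (x + b / real n) / CD_kernel \<mu> n x x)
            \<longlonglongrightarrow> (if a = b then 1
                else sin (inverse (sqrt (4 - x\<^sup>2)) * (b - a)) / (inverse (sqrt (4 - x\<^sup>2)) * (b - a)))))"
proof (intro exI[of _ "\<lambda>_ _. 0"] allI impI ballI)
  \<comment> \<open>The thresholds are the constant 0: divergence of the ratios
    \<open>N (j + 1) / N j\<close> together with \<open>v \<longlonglongrightarrow> 0\<close>
    already makes the sparse sums sublinear.\<close>
  fix N :: "nat \<Rightarrow> nat" and \<mu> :: "real measure" and x a b :: real
  assume N: "(\<forall>j\<ge>1. N j > 0) \<and> strict_mono_on {1..} N \<and>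
      filterlim (\<lambda>j. real (N (j + 1)) / real (N j)) at_top sequentially \<and> (\<forall>k\<ge>1. N (k + 1) \<ge> 0)"
    and \<mu>: "jacobi_measure (\<lambda>n. 1) (sparse_potential v N) \<mu>" and x: "x \<in> {-2<..<2}"
  let ?b = "sparse_potential v N"
  have inj: "inj_on N {1..}" using N by (intro strict_mono_on_imp_inj_on) auto
  have bN: "?b (N j) = v j" if "j \<ge> 1" for j
  proof -
    have "(THE i. i \<ge> 1 \<and> N j = N i) = j"
      using that inj by (intro the_equality) (auto dest: inj_onD)
    then show ?thesis using that by (auto simp: sparse_potential_def)
  qed
  have zero: "?b n = 0" if "n \<notin> N ` {1..}" for n
    using that by (auto simp: sparse_potential_def)
  have "\<forall>\<^sub>F j in sequentially. v j = ?b (N j)"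
    using eventually_ge_at_top[of 1] by eventually_elim (simp add: bN)
  with assms have lim: "(\<lambda>j. ?b (N j)) \<longlonglongrightarrow> 0" by (rule Lim_transform_eventually)
  obtain B where "\<And>j. \<bar>v j\<bar> \<le> B"
    using convergent_imp_Bseq[OF convergentI[OF assms]] by (auto simp: Bseq_def)
  then have B: "\<bar>?b n\<bar> \<le> B" for n
    using zero[of n] bN by (cases "n \<in> N ` {1..}") (auto intro: order_trans[OF abs_ge_zero])
  have sub: "(\<lambda>n. sparse_bound q c ?b n / real n) \<longlonglongrightarrow> 0" if "q \<ge> 1" "c \<ge> 0" for q c
    by (rule sparse_bound_sublinear[of q c N]) (use that N zero lim in auto)
  have "(\<lambda>n. CD_kernel \<mu> n (x + a / real n) (x + b / real n) / CD_kernel \<mu> n x x)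
      \<longlonglongrightarrow> sinc ((b - a) / sqrt (4 - x\<^sup>2))"
    by (rule sine_kernel_limit[OF \<mu> B sub]) (use x in auto)
  \<comment> \<open>This makes the square root nonzero, so the argument of \<open>sinc\<close>
    vanishes exactly when \<open>a = b\<close>.\<close>
  moreover have "x\<^sup>2 < 4" using x abs_square_less_1[of "x / 2"] by (auto simp: power_divide)
  then have "sinc ((b - a) / sqrt (4 - x\<^sup>2)) = (if a = b then 1
      else sin (inverse (sqrt (4 - x\<^sup>2)) * (b - a)) / (inverse (sqrt (4 - x\<^sup>2)) * (b - a)))"
    by (simp add: divide_inverse mult.commute)
  ultimately show "(\<lambda>n. CD_kernel \<mu> n (x + a / real n) (x + b / real n) / CD_kernel \<mu> n x x)
      \<longlonglongrightarrow> (if a = b then 1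
          else sin (inverse (sqrt (4 - x\<^sup>2)) * (b - a)) / (inverse (sqrt (4 - x\<^sup>2)) * (b - a)))"
    by (simp only:)
qed

end
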